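(* Let $\Omega\subset\mathbb{R}^d$ be a bounded convex polyhedral open set, $V\in C^2(\overline\Omega)$, $T>0$, $N\in\mathbb{N}^*$, $\tau=T/N$, and let $\rho^0\in L^1(\Omega)$, $\rho^0\ge0$, have finite entropy $\int_\Omega(\rho^0\log\rho^0-\rho^0+1)<\infty$ and positive mass $\int_\Omega\rho^0>0$. Let $(\mathcal{T},\overline\Sigma,(x_K)_{K\in\mathcal{T}})$ be an admissible mesh of $\Omega$. Then any discrete solution $(\boldsymbol\rho^n)_{n=0}^N$, $(\boldsymbol\theta^{n+1/2})_{n=0}^{N-1}$ of the scheme described in the context, with fluxes $\boldsymbol F^{n+1/2}$, satisfies for every $n=0,\dots,N-1$ the one-step discrete energy dissipation inequality $$\mathcal{E}_{\mathcal{T}}(\boldsymbol\rho^{n+1})+\tau\,\mathcal{D}_\psi(\boldsymbol\theta^{n+1/2},\boldsymbol F^{n+1/2})+\tau\,\mathcal{R}_\psi(\boldsymbol\theta^{n+1/2})\le\mathcal{E}_{\mathcal{T}}(\boldsymbol\rho^n),$$ and equality holds if $\theta_K^{n+1/2}\ge e^{-1}\rho_K^n$ for all $K\in\mathcal{T}$.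
   Context: **Admissible mesh.** A triplet $(\mathcal{T},\overline\Sigma,(x_K)_{K\in\mathcal{T}})$ of cells, facets and cell centers $x_K\in\Omega$ such that: (1) the cells $K\in\mathcal{T}$ (finitely many) are disjoint open polyhedra of Lebesgue measure $m_K>0$, with $\bigcup_K\overline K=\overline\Omega$ and $\sum_Km_K=m_\Omega$ (the Lebesgue measure of $\Omega$); (2) facets $\sigma\in\overline\Sigma$ are closed subsets of $\overline\Omega$, each contained in a hyperplane, with $(d-1)$-dimensional measure $m_\sigma>0$; each facet is either an interior facet $\sigma=K|L:=\partial K\cap\partial L$ for some cells $K\ne L$, or a boundary facet $\sigma\subset\partial K\cap\partial\Omega$ for some cell $K$; distinct facets meet in sets of zero $(d-1)$-measure; $\Sigma\subset\overline\Sigma$ denotes the set of interior facets; (3) for every $K$ there is $\overline\Sigma_K\subset\overline\Sigma$ with $\partial K=\bigcup_{\sigma\in\overline\Sigma_K}\sigma$, $\overline\Sigma=\bigcup_K\overline\Sigma_K$, and $\Sigma_K=\overline\Sigma_K\cap\Sigma$; (4) $x_K=x_L$ iff $K=L$; for $\sigma=K|L$, $x_K-x_L$ is orthogonal to $\sigma$, $d_\sigma:=|x_K-x_L|$, and the unit outward normal to $K$ on $\sigma$ is $n_{K\sigma}=(x_L-x_K)/d_\sigma$. In sums over $\sigma\in\Sigma_K$ or $\sigma\in\Sigma$, write $\sigma=K|L$. **Extrapolation.** Let $f:[0,\infty)\to[e^{-1},\infty)$ be the continuous increasing bijection $f(r)=\exp\big(\frac{r\log r-r+1}{r-1}\big)$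 for $r>0,r\ne1$, $f(1)=1$, $f(0)=e^{-1}$. Set $g(s)=f^{-1}(s)$ if $s>e^{-1}$, $g(s)=0$ otherwise; $\Xi(a,c)=a\,g(c/a)$ if $a>0$ and $\Xi(0,c)=e\,c$, for $c\in\mathbb{R}$. **Scheme.** $V_K=V(x_K)$, $\pi_K=e^{-V_K}$, $\rho^0_K=\frac1{m_K}\int_K\rho^0$. A discrete solution consists of $\boldsymbol\rho^n,\boldsymbol\theta^{n+1/2}\in\mathbb{R}^{\mathcal{T}}$ with, for all $n=0,\dots,N-1$ and $K\in\mathcal{T}$, $$m_K\frac{\rho_K^{n+1}-\rho_K^n}{\tau}+\sum_{\sigma\in\Sigma_K}m_\sigma F_{K\sigma}^{n+1/2}=0,\quad F_{K\sigma}^{n+1/2}=\frac{\sqrt{\pi_K\pi_L}}{d_\sigma}\Big(\frac{\theta_K^{n+1/2}}{\pi_K}-\frac{\theta_L^{n+1/2}}{\pi_L}\Big),\quad \rho_K^{n+1}=\Xi(\rho_K^n,\theta_K^{n+1/2}).$$ It exists, is unique, and satisfies $\rho_K^n\ge0$, $\theta_K^{n+1/2}>0$. **Energy and dissipation.** $H(a)=a\log a-a+1$ for $a>0$, $H(0)=1$; $\mathcal{E}_{\mathcal{T}}(\boldsymbol\rho)=\sum_Km_KH(\rho_K)+\sum_Km_KV_K\rho_K$. Let $\psi(z)=2z\,\mathrm{arcsinh}(z/2)-2\sqrt{4+z^2}+4$ and $\psi^*(\xi)=4(\cosh(\xi/2)-1)$. For $\boldsymbol\rho\in\mathbb{R}^{\mathcal{T}}$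 with positive entries put $\rho_\sigma=\sqrt{\rho_K\rho_L}$ for $\sigma=K|L$; for fluxes $\boldsymbol F=(F_{K\sigma},F_{L\sigma})_{\sigma=K|L\in\Sigma}$ with $F_{K\sigma}+F_{L\sigma}=0$ put $F_\sigma=|F_{K\sigma}|=|F_{L\sigma}|$. Then $$\mathcal{D}_\psi(\boldsymbol\rho,\boldsymbol F)=\sum_{\sigma\in\Sigma}\frac{m_\sigma\rho_\sigma}{d_\sigma}\psi\Big(\frac{d_\sigma F_\sigma}{\rho_\sigma}\Big),\qquad \mathcal{R}_\psi(\boldsymbol\rho)=\sum_{\sigma=K|L\in\Sigma}\frac{m_\sigma\rho_\sigma}{d_\sigma}\psi^*\Big(\log\frac{\rho_K}{\pi_K}-\log\frac{\rho_L}{\pi_L}\Big).$$ *)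

theory Defs
  imports "HOL-Analysis.Analysis"
begin

section \<open>Hausdorff measure\<close>

text \<open>
  Normalised so that in dimension \<open>k\<close> it agrees with Lebesgue measure on \<open>k\<close>-dimensional
  affine subspaces. The empty set is treated separately only because \<open>0 ^ 0 = 1\<close>: for \<open>k = 0\<close>
  every nonempty covering set counts 1, and one gets the counting measure. Covering sets are
  required to be bounded since the library's \<open>diameter\<close> is meaningless on unbounded sets.
\<close>

definition hausdorff_gauge :: "nat \<Rightarrow> 'a::metric_space set \<Rightarrow> ennreal" where
  "hausdorff_gauge k U =
     (if U = {} then 0 else ennreal (unit_ball_vol (real k) * (diameter U / 2) ^ k))"

definition hausdorff_premeasure :: "nat \<Rightarrow> real \<Rightarrow> 'a::metric_space set \<Rightarrow> ennreal" where
  "hausdorff_premeasure k \<delta> A =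
     (INF U \<in> {U :: nat \<Rightarrow> 'a set. A \<subseteq> (\<Union>i. U i) \<and> (\<forall>i. bounded (U i) \<and> diameter (U i) \<le> \<delta>)}.
        \<Sum>i. hausdorff_gauge k (U i))"

definition hausdorff_measure :: "nat \<Rightarrow> 'a::metric_space set \<Rightarrow> ennreal" where
  "hausdorff_measure k A = (SUP \<delta> \<in> {0<..}. hausdorff_premeasure k \<delta> A)"

section \<open>Domains and regularity\<close>

text \<open>
  Open polyhedra need not be convex: the library's \<open>polyhedron\<close> is a finite intersection of
  closed half-spaces, and an open polyhedron is the interior of a finite union of these.
\<close>

definition open_polyhedron :: "'a::euclidean_space set \<Rightarrow> bool" where
  "open_polyhedron S \<longleftrightarrow>
     (\<exists>\<P>. finite \<P> \<and> (\<forall>P \<in> \<P>. polyhedron P) \<and> S = interior (\<Union>\<P>))"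

text \<open>
  \<open>C\<^sup>2\<close> up to the boundary: the derivatives of order at most 2 in the open set \<open>S\<close> extend
  continuously to the closure.
\<close>

definition C2_closure :: "'a::euclidean_space set \<Rightarrow> ('a \<Rightarrow> real) \<Rightarrow> bool" where
  "C2_closure S V \<longleftrightarrow>
     (\<exists>(V' :: 'a \<Rightarrow> 'a \<Rightarrow>\<^sub>L real) (V'' :: 'a \<Rightarrow> 'a \<Rightarrow>\<^sub>L 'a \<Rightarrow>\<^sub>L real).
        continuous_on (closure S) V \<and> continuous_on (closure S) V' \<and>
        continuous_on (closure S) V'' \<and>
        (\<forall>x \<in> S. (V has_derivative blinfun_apply (V' x)) (at x) \<and>
                 (V' has_derivative blinfun_apply (V'' x)) (at x)))"

section \<open>Admissible meshes\<close>

text \<open>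
  Cells and facets are the point sets themselves; \<open>facets_of m K\<close> is the set of all facets
  (interior and boundary) making up the boundary of \<open>K\<close>.
\<close>

record 'a mesh =
  cells :: "'a set set"
  facets :: "'a set set"
  facets_of :: "'a set \<Rightarrow> 'a set set"
  center :: "'a set \<Rightarrow> 'a"

definition vol :: "'a::euclidean_space set \<Rightarrow> real" where
  "vol K = measure lebesgue K"

definition area :: "'a::euclidean_space set \<Rightarrow> real" where
  "area \<sigma> = enn2real (hausdorff_measure (DIM('a) - 1) \<sigma>)"

definition interface :: "'a::euclidean_space set \<Rightarrow> 'a set \<Rightarrow> 'a set" where
  "interface K L = frontier K \<inter> frontier L"

definition interior_facets :: "'a::euclidean_space mesh \<Rightarrow> 'a set set" where
  "interior_facets m =
     {\<sigma> \<in> facets m. \<exists>K \<in> cells m. \<exists>L \<in> cells m. K \<noteq> L \<and> \<sigma> = interface K L}"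

definition interior_facets_of :: "'a::euclidean_space mesh \<Rightarrow> 'a set \<Rightarrow> 'a set set" where
  "interior_facets_of m K = facets_of m K \<inter> interior_facets m"

text \<open>
  \<open>\<nu>\<close> is the outward unit normal to \<open>K\<close> on the flat set \<open>\<sigma>\<close>. Which side is the outer one is
  tested only at almost every point of \<open>\<sigma>\<close>, as it is meaningless at the edges of \<open>\<sigma>\<close>.
\<close>

definition outward_unit_normal ::
    "'a::euclidean_space set \<Rightarrow> 'a set \<Rightarrow> 'a \<Rightarrow> bool" where
  "outward_unit_normal K \<sigma> \<nu> \<longleftrightarrow>
     norm \<nu> = 1 \<and> (\<forall>y \<in> \<sigma>. \<forall>z \<in> \<sigma>. \<nu> \<bullet> (y - z) = 0) \<and>
     (\<exists>Z. hausdorff_measure (DIM('a) - 1) Z = 0 \<and>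
        (\<forall>y \<in> \<sigma> - Z. \<forall>\<^sub>F t in at_right 0. y - t *\<^sub>R \<nu> \<in> K \<and> y + t *\<^sub>R \<nu> \<notin> K))"

definition admissible_mesh :: "'a::euclidean_space set \<Rightarrow> 'a mesh \<Rightarrow> bool" where
  "admissible_mesh \<Omega> m \<longleftrightarrow>
     finite (cells m) \<and> pairwise disjnt (cells m) \<and>
     (\<forall>K \<in> cells m. open_polyhedron K \<and> 0 < vol K) \<and>
     (\<Union>K \<in> cells m. closure K) = closure \<Omega> \<and>
     (\<Sum>K \<in> cells m. vol K) = vol \<Omega> \<and>
     (\<forall>\<sigma> \<in> facets m. closed \<sigma> \<and> \<sigma> \<subseteq> closure \<Omega> \<and>
        (\<exists>a b. a \<noteq> 0 \<and> \<sigma> \<subseteq> {x. a \<bullet> x = b}) \<and> 0 < area \<sigma> \<and>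
        (\<sigma> \<in> interior_facets m \<or> (\<exists>K \<in> cells m. \<sigma> \<subseteq> frontier K \<inter> frontier \<Omega>))) \<and>
     (\<forall>\<sigma> \<in> facets m. \<forall>\<sigma>' \<in> facets m. \<sigma> \<noteq> \<sigma>' \<longrightarrow>
        hausdorff_measure (DIM('a) - 1) (\<sigma> \<inter> \<sigma>') = 0) \<and>
     (\<forall>K \<in> cells m. facets_of m K \<subseteq> facets m \<and> frontier K = \<Union>(facets_of m K)) \<and>
     facets m = (\<Union>K \<in> cells m. facets_of m K) \<and>
     (\<forall>K \<in> cells m. center m K \<in> \<Omega>) \<and>
     (\<forall>K \<in> cells m. \<forall>L \<in> cells m. center m K = center m L \<longleftrightarrow> K = L) \<and>
     (\<forall>K \<in> cells m. \<forall>L \<in> cells m. K \<noteq> L \<and> interface K L \<in> facets m \<longrightarrow>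
        (\<forall>y \<in> interface K L. \<forall>z \<in> interface K L. (center m K - center m L) \<bullet> (y - z) = 0) \<and>
        outward_unit_normal K (interface K L)
          ((center m L - center m K) /\<^sub>R dist (center m K) (center m L)))"

text \<open>
  The two cells of an interior facet, in arbitrary order; everything below is symmetric under
  exchanging them.
\<close>

definition facet_cells :: "'a::euclidean_space mesh \<Rightarrow> 'a set \<Rightarrow> 'a set \<times> 'a set" where
  "facet_cells m \<sigma> =
     (SOME (K, L). K \<in> cells m \<and> L \<in> cells m \<and> K \<noteq> L \<and> \<sigma> = interface K L)"

definition neighbour :: "'a::euclidean_space mesh \<Rightarrow> 'a set \<Rightarrow> 'a set \<Rightarrow> 'a set" where
  "neighbour m K \<sigma> = (THE L. L \<in> cells m \<and> K \<noteq> L \<and> \<sigma> = interface K L)"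

definition facet_dist :: "'a::euclidean_space mesh \<Rightarrow> 'a set \<Rightarrow> real" where
  "facet_dist m \<sigma> = (case facet_cells m \<sigma> of (K, L) \<Rightarrow> dist (center m K) (center m L))"

section \<open>Extrapolation\<close>

definition extrap_f :: "real \<Rightarrow> real" where
  "extrap_f r =
     (if r = 0 then exp (-1) else if r = 1 then 1
      else exp ((r * ln r - r + 1) / (r - 1)))"

definition extrap_g :: "real \<Rightarrow> real" where
  "extrap_g s = (if exp (-1) < s then the_inv_into {0..} extrap_f s else 0)"

text \<open>Only used for \<open>a \<ge> 0\<close>.\<close>

definition extrap :: "real \<Rightarrow> real \<Rightarrow> real" where
  "extrap a c = (if 0 < a then a * extrap_g (c / a) else exp 1 * c)"

section \<open>Scheme\<close>

text \<open>
  A vector indexed by the cells is a function on sets of which only the values on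
  \<open>cells m\<close> matter.
\<close>

definition cell_weight ::
    "'a::euclidean_space mesh \<Rightarrow> ('a \<Rightarrow> real) \<Rightarrow> 'a set \<Rightarrow> real" where
  "cell_weight m V K = exp (- V (center m K))"

definition scheme_flux ::
    "'a::euclidean_space mesh \<Rightarrow> ('a \<Rightarrow> real) \<Rightarrow> ('a set \<Rightarrow> real) \<Rightarrow> 'a set \<Rightarrow> 'a set \<Rightarrow> real"
  where
  "scheme_flux m V \<theta> K \<sigma> =
     (let L = neighbour m K \<sigma>; \<pi> = cell_weight m V
      in sqrt (\<pi> K * \<pi> L) / facet_dist m \<sigma> * (\<theta> K / \<pi> K - \<theta> L / \<pi> L))"

text \<open>In \<open>\<theta>\<close>, the index \<open>n\<close> stands for \<open>n + 1/2\<close>.\<close>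

definition discrete_solution ::
    "'a::euclidean_space mesh \<Rightarrow> ('a \<Rightarrow> real) \<Rightarrow> ('a \<Rightarrow> real) \<Rightarrow> real \<Rightarrow> nat \<Rightarrow>
     (nat \<Rightarrow> 'a set \<Rightarrow> real) \<Rightarrow> (nat \<Rightarrow> 'a set \<Rightarrow> real) \<Rightarrow> bool" where
  "discrete_solution m V \<rho>0 \<tau> N \<rho> \<theta> \<longleftrightarrow>
     (\<forall>K \<in> cells m. \<rho> 0 K = (LINT x:K|lebesgue. \<rho>0 x) / vol K) \<and>
     (\<forall>n < N. \<forall>K \<in> cells m.
        vol K * ((\<rho> (Suc n) K - \<rho> n K) / \<tau>) +
          (\<Sum>\<sigma> \<in> interior_facets_of m K. area \<sigma> * scheme_flux m V (\<theta> n) K \<sigma>) = 0 \<and>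
        \<rho> (Suc n) K = extrap (\<rho> n K) (\<theta> n K))"

section \<open>Energy and dissipation\<close>

definition entropy_density :: "real \<Rightarrow> real" where
  "entropy_density a = (if a = 0 then 1 else a * ln a - a + 1)"

definition discrete_energy ::
    "'a::euclidean_space mesh \<Rightarrow> ('a \<Rightarrow> real) \<Rightarrow> ('a set \<Rightarrow> real) \<Rightarrow> real" where
  "discrete_energy m V \<rho> =
     (\<Sum>K \<in> cells m. vol K * entropy_density (\<rho> K)) +
     (\<Sum>K \<in> cells m. vol K * V (center m K) * \<rho> K)"

definition psi :: "real \<Rightarrow> real" where
  "psi z = 2 * z * arsinh (z / 2) - 2 * sqrt (4 + z\<^sup>2) + 4"

definition psi_star :: "real \<Rightarrow> real" where
  "psi_star \<xi> = 4 * (cosh (\<xi> / 2) - 1)"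

definition facet_density ::
    "'a::euclidean_space mesh \<Rightarrow> ('a set \<Rightarrow> real) \<Rightarrow> 'a set \<Rightarrow> real" where
  "facet_density m \<rho> \<sigma> = (case facet_cells m \<sigma> of (K, L) \<Rightarrow> sqrt (\<rho> K * \<rho> L))"

definition facet_flux ::
    "'a::euclidean_space mesh \<Rightarrow> ('a set \<Rightarrow> 'a set \<Rightarrow> real) \<Rightarrow> 'a set \<Rightarrow> real" where
  "facet_flux m F \<sigma> = (case facet_cells m \<sigma> of (K, L) \<Rightarrow> \<bar>F K \<sigma>\<bar>)"

definition dissipation_flux ::
    "'a::euclidean_space mesh \<Rightarrow> ('a set \<Rightarrow> real) \<Rightarrow> ('a set \<Rightarrow> 'a set \<Rightarrow> real) \<Rightarrow> real" where
  "dissipation_flux m \<rho> F =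
     (\<Sum>\<sigma> \<in> interior_facets m.
        area \<sigma> * facet_density m \<rho> \<sigma> / facet_dist m \<sigma> *
        psi (facet_dist m \<sigma> * facet_flux m F \<sigma> / facet_density m \<rho> \<sigma>))"

definition dissipation_slope ::
    "'a::euclidean_space mesh \<Rightarrow> ('a \<Rightarrow> real) \<Rightarrow> ('a set \<Rightarrow> real) \<Rightarrow> real" where
  "dissipation_slope m V \<rho> =
     (\<Sum>\<sigma> \<in> interior_facets m.
        case facet_cells m \<sigma> of (K, L) \<Rightarrow>
          area \<sigma> * facet_density m \<rho> \<sigma> / facet_dist m \<sigma> *
          psi_star (ln (\<rho> K / cell_weight m V K) - ln (\<rho> L / cell_weight m V L)))"

end

theory Submission
  imports Defs
begin

text \<open>
  Write \<open>u = \<theta> / \<pi>\<close>. The extrapolation is designed so that, on each cell,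
  \<open>H(\<rho>') - H(\<rho>) \<le> (\<rho>' - \<rho>) ln \<theta>\<close>, with equality unless the extrapolation is truncated.
  Hence the energy increment is at most the sum of \<open>m\<^sub>K (\<rho>' - \<rho>) ln u\<close>, which discrete
  integration by parts turns into minus a sum over the facets of \<open>m\<^sub>\<sigma> F (ln u\<^sub>K - ln u\<^sub>L)\<close>.
  Since \<open>d\<^sub>\<sigma> F / \<theta>\<^sub>\<sigma> = 2 sinh ((ln u\<^sub>K - ln u\<^sub>L) / 2)\<close>, this product is the equality case of
  the Fenchel-Young inequality for \<open>\<psi>\<close> and \<open>\<psi>\<^sup>*\<close>.

  Integration by parts needs that an interior facet separates exactly one pair of cells and is
  listed among the facets of exactly these two. The cells being polyhedra, near every point of the
  facet off finitely many flats of codimension 2 the two cells fill both sides of the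
  hyperplane of the facet, so that no third cell and no boundary facet can come close; and
  such flats are null for the Hausdorff measure of codimension 1.
\<close>

section \<open>Null sets of the Hausdorff measure\<close>

lemma hausdorff_gauge_empty [simp]: "hausdorff_gauge k {} = 0"
  by (simp add: hausdorff_gauge_def)

text \<open>An infimum in \<open>ennreal\<close> is 0 iff for each positive \<epsilon> some
  competitor is at most \<epsilon>, and a supremum is 0 iff all its members are. Nullity thus
  becomes a statement about covers alone.\<close>

lemma hausdorff_null_iff:
  fixes A :: "'a::metric_space set"
  shows "hausdorff_measure k A = 0 \<longleftrightarrow>
    (\<forall>\<delta>>0. \<forall>\<epsilon>>0. \<exists>U. A \<subseteq> (\<Union>i. U i) \<and> (\<forall>i. bounded (U i) \<and> diameter (U i) \<le> \<delta>) \<and>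
       (\<Sum>i. hausdorff_gauge k (U i)) \<le> ennreal \<epsilon>)"
    (is "_ \<longleftrightarrow> (\<forall>\<delta>>0. \<forall>\<epsilon>>0. ?P \<delta> \<epsilon>)")
proof -
  have "hausdorff_premeasure k \<delta> A = 0 \<longleftrightarrow> (\<forall>\<epsilon>>0. ?P \<delta> \<epsilon>)" for \<delta>
  proof
    assume 0: "hausdorff_premeasure k \<delta> A = 0"
    show "\<forall>\<epsilon>>0. ?P \<delta> \<epsilon>"
    proof (intro allI impI)
      fix \<epsilon> :: real assume "\<epsilon> > 0"
      then have "hausdorff_premeasure k \<delta> A < ennreal \<epsilon>" using 0 by simp
      then show "?P \<delta> \<epsilon>"
        unfolding hausdorff_premeasure_def INF_less_iff by (auto intro: less_imp_le)
    qed
  next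
    assume P: "\<forall>\<epsilon>>0. ?P \<delta> \<epsilon>"
    have le: "hausdorff_premeasure k \<delta> A \<le> 0 + ennreal \<epsilon>" if "\<epsilon> > 0" for \<epsilon>
    proof -
      have "?P \<delta> \<epsilon>" using P that by simp
      then obtain U where "A \<subseteq> (\<Union>i. U i)" "\<forall>i. bounded (U i) \<and> diameter (U i) \<le> \<delta>"
        and *: "(\<Sum>i. hausdorff_gauge k (U i)) \<le> ennreal \<epsilon>"
        by (elim exE conjE)
      then have "hausdorff_premeasure k \<delta> A \<le> (\<Sum>i. hausdorff_gauge k (U i))"
        unfolding hausdorff_premeasure_def by (intro INF_lower) auto
      then show ?thesis using * by simp
    qed
    have "hausdorff_premeasure k \<delta> A \<le> 0"
      by (rule ennreal_le_epsilon) (rule le)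
    then show "hausdorff_premeasure k \<delta> A = 0" by simp
  qed
  moreover have "hausdorff_measure k A = bot \<longleftrightarrow>
      (\<forall>\<delta>\<in>{0<..}. hausdorff_premeasure k \<delta> A = bot)"
    unfolding hausdorff_measure_def by (rule SUP_bot_conv)
  ultimately show ?thesis by (simp add: bot_ennreal Ball_def)
qed

lemma hausdorff_null_subset:
  "hausdorff_measure k B = 0 \<Longrightarrow> A \<subseteq> B \<Longrightarrow> hausdorff_measure k A = 0"
  unfolding hausdorff_null_iff by (meson subset_trans)

lemma hausdorff_null_empty [simp]: "hausdorff_measure k {} = 0"
  unfolding hausdorff_null_iff
  by (intro allI impI exI[of _ "\<lambda>_. {}"]) auto

text \<open>The usual geometric-series argument: the i-th set gets a cover of total gauge
  \<open>\<epsilon> * (1/2) ^ Suc i\<close>, and the pairing of naturals merges all these covers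
  into one sequence.\<close>

lemma hausdorff_null_UN_nat:
  fixes A :: "nat \<Rightarrow> 'a::metric_space set"
  assumes "\<And>i. hausdorff_measure k (A i) = 0"
  shows "hausdorff_measure k (\<Union>i. A i) = 0"
  unfolding hausdorff_null_iff
proof (intro allI impI)
  fix \<delta> \<epsilon> :: real assume \<delta>: "\<delta> > 0" and \<epsilon>: "\<epsilon> > 0"
  have "\<exists>U. A i \<subseteq> (\<Union>j. U j) \<and> (\<forall>j. bounded (U j) \<and> diameter (U j) \<le> \<delta>) \<and>
      (\<Sum>j. hausdorff_gauge k (U j)) \<le> ennreal (\<epsilon> * (1/2) ^ Suc i)" for i
    using assms[of i] \<delta> \<epsilon> unfolding hausdorff_null_iff
    by (metis half_gt_zero_iff mult_pos_pos zero_less_one zero_less_power)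
  then obtain U where U: "\<And>i. A i \<subseteq> (\<Union>j. U i j)"
      "\<And>i j. bounded (U i j)" "\<And>i j. diameter (U i j) \<le> \<delta>"
      "\<And>i. (\<Sum>j. hausdorff_gauge k (U i j)) \<le> ennreal (\<epsilon> * (1/2) ^ Suc i)"
    by metis
  define W where "W = (\<lambda>n. case prod_decode n of (i, j) \<Rightarrow> U i j)"
  have "(\<Sum>n. hausdorff_gauge k (W n)) = (\<Sum>i. \<Sum>j. hausdorff_gauge k (U i j))"
    using suminf_ennreal_2dimen[of "\<lambda>i. \<Sum>j. hausdorff_gauge k (U i j)"
        "\<lambda>(i, j). hausdorff_gauge k (U i j)"]
    by (simp add: W_def case_prod_beta)
  also have "\<dots> \<le> (\<Sum>i. ennreal (\<epsilon> * (1/2) ^ Suc i))"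
    by (intro suminf_le U) auto
  also have "\<dots> = ennreal (\<Sum>i. \<epsilon> * (1/2) ^ Suc i)"
    using \<epsilon> by (intro suminf_ennreal2 summable_mult sums_summable[OF power_half_series]) auto
  also have "(\<Sum>i. \<epsilon> * (1/2) ^ Suc i) = \<epsilon>"
    using sums_mult[OF power_half_series, of \<epsilon>] by (simp add: sums_iff)
  finally have "(\<Sum>n. hausdorff_gauge k (W n)) \<le> ennreal \<epsilon>" .
  moreover have "(\<Union>i. A i) \<subseteq> (\<Union>n. W n)"
  proof
    fix x assume "x \<in> (\<Union>i. A i)"
    then obtain i j where "x \<in> U i j" using U(1) by blast
    then have "x \<in> W (prod_encode (i, j))" by (simp add: W_def)
    then show "x \<in> (\<Union>n. W n)" by blast
  qed
  moreover have "\<forall>n. bounded (W n) \<and> diameter (W n) \<le> \<delta>"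
    using U by (auto simp: W_def split: prod.split)
  ultimately show "\<exists>U. (\<Union>i. A i) \<subseteq> (\<Union>i. U i) \<and>
      (\<forall>i. bounded (U i) \<and> diameter (U i) \<le> \<delta>) \<and> (\<Sum>i. hausdorff_gauge k (U i)) \<le> ennreal \<epsilon>"
    by blast
qed

lemma hausdorff_null_UN:
  assumes "countable I" "\<And>i. i \<in> I \<Longrightarrow> hausdorff_measure k (A i) = 0"
  shows "hausdorff_measure k (\<Union>i\<in>I. A i) = 0"
proof (cases "I = {}")
  case False
  then have I: "range (from_nat_into I) = I" using assms(1) by simp
  have "hausdorff_measure k (\<Union>n. A (from_nat_into I n)) = 0"
    using assms(2) False by (intro hausdorff_null_UN_nat) (simp add: from_nat_into)
  moreover have "(\<Union>n. A (from_nat_into I n)) = (\<Union>i\<in>I. A i)"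
    using arg_cong[OF I, of "\<lambda>J. \<Union> (A ` J)"] by (simp add: image_image)
  ultimately show ?thesis by simp
qed simp

lemma hausdorff_null_Un:
  assumes "hausdorff_measure k A = 0" "hausdorff_measure k B = 0"
  shows "hausdorff_measure k (A \<union> B) = 0"
  using hausdorff_null_UN[of "{A, B}" k "\<lambda>X. X"] assms by auto

lemma area_null: "area \<sigma> > 0 \<Longrightarrow> hausdorff_measure (DIM('a) - 1) (\<sigma> :: 'a::euclidean_space set) \<noteq> 0"
  by (auto simp: area_def)

text \<open>Covers in the Hausdorff premeasure are infinite sequences, so a finite family is
  enumerated and padded with the empty set, whose gauge is 0.\<close>

lemma suminf_finite_cover:
  fixes F :: "'i \<Rightarrow> 'b set" and f :: "'b set \<Rightarrow> ennreal"
  assumes "finite I" "f {} = 0" "\<And>i. i \<in> I \<Longrightarrow> f (F i) \<le> c"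
  obtains U :: "nat \<Rightarrow> 'b set" where "(\<Union>i\<in>I. F i) \<subseteq> (\<Union>n. U n)" "range U \<subseteq> insert {} (F ` I)"
    "(\<Sum>n. f (U n)) \<le> of_nat (card I) * c"
proof -
  obtain h where h: "bij_betw h {..<card I} I"
    using ex_bij_betw_nat_finite[OF assms(1)] by (auto simp: atLeast0LessThan)
  define U where "U = (\<lambda>n. if n < card I then F (h n) else {})"
  show thesis
  proof
    show "(\<Union>i\<in>I. F i) \<subseteq> (\<Union>n. U n)"
    proof
      fix x assume "x \<in> (\<Union>i\<in>I. F i)"
      then obtain i where i: "i \<in> I" "x \<in> F i" by blast
      then obtain n where "n < card I" "h n = i"
        using h by (metis bij_betw_imp_surj_on imageE lessThan_iff)
      then have "x \<in> U n" using i by (simp add: U_def)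
      then show "x \<in> (\<Union>n. U n)" by blast
    qed
    show "range U \<subseteq> insert {} (F ` I)"
      using h by (auto simp: U_def bij_betw_def)
    have "(\<Sum>n. f (U n)) = (\<Sum>n<card I. f (U n))"
      by (intro suminf_finite) (auto simp: U_def assms(2))
    also have "\<dots> \<le> (\<Sum>n<card I. c)"
      using h by (intro sum_mono) (auto simp: U_def bij_betw_def intro!: assms(3))
    finally show "(\<Sum>n. f (U n)) \<le> of_nat (card I) * c" by simp
  qed
qed

text \<open>Box counting: a bounded set of affine dimension p meets O(n^p) grid cubes of side 1/n,
  each of gauge O(n^(-k)). For p < k the total is O(1/n).\<close>

lemma hausdorff_null_aff_dim:
  fixes S :: "'a::euclidean_space set"
  assumes S: "bounded S" and dim: "aff_dim S < int k"
  shows "hausdorff_measure k S = 0"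
proof (cases "S = {}")
  case False
  then obtain y where y: "y \<in> S" by blast
  \<comment> \<open>\<open>W\<close> is the direction space of the affine hull of \<open>S\<close>;
    an orthonormal basis of it supplies the p coordinates in which the grid is laid.\<close>
  define W where "W = span ((\<lambda>x. x - y) ` S)"
  obtain B where B: "pairwise orthogonal B" "\<And>w. w \<in> B \<Longrightarrow> norm w = 1" "independent B"
      "card B = dim W" "span B = W"
    using orthonormal_basis_subspace[of W] unfolding W_def by (metis subspace_span)
  define p where "p = card B"
  have finB: "finite B" using B(3) by (rule independent_imp_finite)
  have "aff_dim S = int p"
    unfolding p_def B(4) W_def dim_span
    by (rule aff_dim_eq_dim_subtract) (simp add: hull_inc y)
  then have pk: "p < k" using dim by simp
  obtain R' where R': "\<And>x. x \<in> S \<Longrightarrow> norm (x - y) \<le> R'"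
    using S bounded_minus[of S "{y}"] by (auto simp: bounded_iff)
  define R where "R = nat \<lceil>R'\<rceil> + 1"
  have R: "norm (x - y) \<le> real R" if "x \<in> S" for x
    using R'[OF that] unfolding R_def by linarith
  have R1: "R \<ge> 1" by (simp add: R_def)
  \<comment> \<open>The factor \<open>(3 * real R) ^ p\<close> comes from the number of cubes, the
    rest from the gauge of a set of diameter p/n; the powers of n are split off.\<close>
  define C where "C = (3 * real R) ^ p * unit_ball_vol (real k) * (real p / 2) ^ k"
  have C: "C \<ge> 0" by (simp add: C_def)
  have cover: "\<exists>U. S \<subseteq> (\<Union>i. U i) \<and> (\<forall>i. bounded (U i) \<and> diameter (U i) \<le> real p / real n) \<and>
       (\<Sum>i. hausdorff_gauge k (U i)) \<le> ennreal (C / real n)" if n: "n \<ge> 1" for n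
  proof -
    define M where "M = int (R * n)"
    define I where "I = (B \<rightarrow>\<^sub>E {- M..M})"
    \<comment> \<open>\<open>F q\<close> is the piece of \<open>S\<close> in the cube with integer
      index \<open>q\<close>; rounding down n times the coordinates makes these pieces cover
      \<open>S\<close>.\<close>
    define F where "F = (\<lambda>q. {x \<in> S. \<forall>w\<in>B. \<lfloor>real n * ((x - y) \<bullet> w)\<rfloor> = q w})"
    have finI: "finite I" unfolding I_def using finB by (intro finite_PiE) auto
    have diam: "norm (x - x') \<le> real p / real n" if "x \<in> F q" "x' \<in> F q" for x x' q
    proof -
      have "x - y \<in> W" "x' - y \<in> W" using that by (auto simp: F_def W_def intro: span_base)
      then have "(x - y) - (x' - y) \<in> W" unfolding W_def by (rule span_diff)
      then have "x - x' \<in> span B" using B(5) by simp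
      then have "norm (x - x') = norm (\<Sum>w\<in>B. ((x - x') \<bullet> w) *\<^sub>R w)"
        using orthonormal_basis_expand[OF B(1,2) _ finB] by simp
      also have "\<dots> \<le> (\<Sum>w\<in>B. norm (((x - x') \<bullet> w) *\<^sub>R w))" by (rule norm_sum)
      also have "\<dots> \<le> (\<Sum>w\<in>B. 1 / real n)"
      proof (rule sum_mono)
        fix w assume w: "w \<in> B"
        have "\<lfloor>real n * ((x - y) \<bullet> w)\<rfloor> = \<lfloor>real n * ((x' - y) \<bullet> w)\<rfloor>"
          using that w by (auto simp: F_def)
        then have "\<bar>real n * ((x - y) \<bullet> w) - real n * ((x' - y) \<bullet> w)\<bar> \<le> 1"
          by linarith
        moreover have "real n * ((x - y) \<bullet> w) - real n * ((x' - y) \<bullet> w) = real n * ((x - x') \<bullet> w)"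
          by (simp add: algebra_simps)
        ultimately have "real n * \<bar>(x - x') \<bullet> w\<bar> \<le> 1" by (simp add: abs_mult)
        then show "norm (((x - x') \<bullet> w) *\<^sub>R w) \<le> 1 / real n"
          using n B(2)[OF w] by (simp add: field_simps)
      qed
      finally show ?thesis by (simp add: p_def)
    qed
    have diamF: "diameter (F q) \<le> real p / real n" for q
      by (rule diameter_le) (auto intro: diam)
    have bddF: "bounded (F q)" for q
      using S by (rule bounded_subset) (auto simp: F_def)
    have gauge: "hausdorff_gauge k (F q)
        \<le> ennreal (unit_ball_vol (real k) * (real p / real n / 2) ^ k)" for q
      unfolding hausdorff_gauge_def using diamF[of q] bddF[of q]
      by (auto intro!: ennreal_leI mult_left_mono power_mono divide_right_mono
          simp: diameter_ge_0)
    obtain U where U: "(\<Union>q\<in>I. F q) \<subseteq> (\<Union>n. U n)" "range U \<subseteq> insert {} (F ` I)"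
      "(\<Sum>i. hausdorff_gauge k (U i))
         \<le> of_nat (card I) * ennreal (unit_ball_vol (real k) * (real p / real n / 2) ^ k)"
      by (rule suminf_finite_cover[OF finI hausdorff_gauge_empty gauge])
    have "S \<subseteq> (\<Union>q\<in>I. F q)"
    proof
      fix x assume x: "x \<in> S"
      define q where "q = (\<lambda>w\<in>B. \<lfloor>real n * ((x - y) \<bullet> w)\<rfloor>)"
      have "\<lfloor>real n * ((x - y) \<bullet> w)\<rfloor> \<in> {- M..M}" if "w \<in> B" for w
      proof -
        have "\<bar>(x - y) \<bullet> w\<bar> \<le> norm (x - y) * norm w" by (rule Cauchy_Schwarz_ineq2)
        also have "\<dots> \<le> real R" using R[OF x] B(2)[OF that] by simp
        finally have "real n * \<bar>(x - y) \<bullet> w\<bar> \<le> real n * real R" by (rule mult_left_mono) simp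
        then have "\<bar>real n * ((x - y) \<bullet> w)\<bar> \<le> real_of_int M"
          by (simp add: M_def abs_mult mult.commute)
        then show ?thesis by (auto simp: le_floor_iff floor_le_iff)
      qed
      then have "q \<in> I" by (auto simp: I_def q_def)
      moreover have "x \<in> F q" using x by (simp add: F_def q_def)
      ultimately show "x \<in> (\<Union>q\<in>I. F q)" by blast
    qed
    moreover have "bounded (U i) \<and> diameter (U i) \<le> real p / real n" for i
    proof -
      have "U i \<in> insert {} (F ` I)" using U(2) by blast
      then show ?thesis using diamF bddF by auto
    qed
    moreover have "(\<Sum>i. hausdorff_gauge k (U i)) \<le> ennreal (C / real n)"
    proof -
      have "card I = (2 * R * n + 1) ^ p"
        using finB by (simp add: I_def card_PiE p_def M_def nat_add_distrib nat_mult_distrib mult.assoc)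
      \<comment> \<open>\<open>R * n\<close> is at least 1, which absorbs the extra 1 counting the
        index 0.\<close>
      also have "\<dots> \<le> (3 * R * n) ^ p"
        using R1 n by (intro power_mono) auto
      finally have "real (card I) \<le> real ((3 * R * n) ^ p)"
        by (rule of_nat_mono)
      then have card: "real (card I) \<le> (3 * real R) ^ p * real n ^ p"
        by (simp add: power_mult_distrib)
      have "real n ^ p * real n \<le> real n ^ k"
        using n pk power_increasing[of "Suc p" k "real n"] by (simp add: mult.commute)
      then have nn: "real n ^ p / real n ^ k \<le> 1 / real n"
        using n by (simp add: field_simps)
      have "of_nat (card I) * ennreal (unit_ball_vol (real k) * (real p / real n / 2) ^ k)
          = ennreal (real (card I) * (unit_ball_vol (real k) * (real p / real n / 2) ^ k))"
        by (simp add: ennreal_mult ennreal_of_nat_eq_real_of_nat)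
      also have "real (card I) * (unit_ball_vol (real k) * (real p / real n / 2) ^ k)
          \<le> ((3 * real R) ^ p * real n ^ p) * (unit_ball_vol (real k) * (real p / real n / 2) ^ k)"
        by (intro mult_right_mono card) simp
      also have "\<dots> = C * (real n ^ p / real n ^ k)"
        by (simp add: C_def power_divide mult_ac)
      also have "\<dots> \<le> C * (1 / real n)"
        by (intro mult_left_mono nn C)
      finally show ?thesis using U(3) by (auto intro: order_trans ennreal_leI)
    qed
    ultimately show ?thesis using U(1) by blast
  qed
  show ?thesis
    unfolding hausdorff_null_iff
  proof (intro allI impI)
    fix \<delta> \<epsilon> :: real assume \<delta>: "\<delta> > 0" and \<epsilon>: "\<epsilon> > 0"
    obtain n :: nat where n: "real n > max (real p / \<delta>) (max (C / \<epsilon>) 1)"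
      using reals_Archimedean2 by blast
    then have "n \<ge> 1" "real p / real n \<le> \<delta>" "C / real n \<le> \<epsilon>"
      using \<delta> \<epsilon> by (auto simp: field_simps)
    moreover obtain U where U: "S \<subseteq> (\<Union>i. U i)" "\<And>i. bounded (U i)"
        "\<And>i. diameter (U i) \<le> real p / real n"
        "(\<Sum>i. hausdorff_gauge k (U i)) \<le> ennreal (C / real n)"
      using cover[OF \<open>n \<ge> 1\<close>] by blast
    ultimately have "(\<Sum>i. hausdorff_gauge k (U i)) \<le> ennreal \<epsilon>" "\<And>i. diameter (U i) \<le> \<delta>"
      by (auto intro: order_trans[OF U(3)] order_trans[OF U(4)] ennreal_leI)
    then show "\<exists>U. S \<subseteq> (\<Union>i. U i) \<and> (\<forall>i. bounded (U i) \<and> diameter (U i) \<le> \<delta>) \<and>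
       (\<Sum>i. hausdorff_gauge k (U i)) \<le> ennreal \<epsilon>"
      using U(1,2) by blast
  qed
qed simp

section \<open>The extrapolation and the dissipation potentials\<close>

text \<open>The logarithm of f. It is the secant slope of the entropy H between 1 and r, since H(1)
  = 0; at r = 0 the convention \<open>ln 0 = 0\<close> gives the correct value -1.\<close>

definition ln_extrap_f :: "real \<Rightarrow> real" where
  "ln_extrap_f r = (r * ln r - r + 1) / (r - 1)"

lemma extrap_f_eq: "0 \<le> r \<Longrightarrow> r \<noteq> 1 \<Longrightarrow> extrap_f r = exp (ln_extrap_f r)"
  by (auto simp: extrap_f_def ln_extrap_f_def)

lemma extrap_f_one [simp]: "extrap_f 1 = 1"
  by (simp add: extrap_f_def)

text \<open>The derivative is (x - 1 - ln x) / (x - 1)^2, positive because ln lies strictly below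
  its tangent at 1. The interval must avoid the singular point 1.\<close>

lemma ln_extrap_f_strict_mono_pos:
  assumes "0 < r" "r < s" "1 \<notin> {r..s}"
  shows "ln_extrap_f r < ln_extrap_f s"
proof (rule DERIV_pos_imp_increasing[OF assms(2)])
  fix x assume x: "r \<le> x" "x \<le> s"
  then have x0: "x > 0" "x \<noteq> 1" using assms by auto
  have "(ln_extrap_f has_real_derivative ((x - 1 - ln x) / (x - 1)\<^sup>2)) (at x)"
    unfolding ln_extrap_f_def using x0
    by (auto intro!: derivative_eq_intros simp: field_simps power2_eq_square)
  moreover have "(x - 1 - ln x) / (x - 1)\<^sup>2 > 0"
    using x0 ln_le_minus_one[of x] ln_eq_minus_one[of x] by (intro divide_pos_pos) force+
  ultimately show "\<exists>y. (ln_extrap_f has_real_derivative y) (at x) \<and> y > 0" by blast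
qed

text \<open>The tangent bound for ln at \<open>1 / r\<close>, multiplied by r.\<close>

lemma entropy_num_pos:
  assumes "0 < r" "r \<noteq> (1::real)" shows "r * ln r - r + 1 > 0"
proof -
  have "ln (1 / r) < 1 / r - 1"
    using assms ln_le_minus_one[of "1 / r"] ln_eq_minus_one[of "1 / r"] by force
  then have "- ln r < 1 / r - 1" using assms by (simp add: ln_div)
  then have "r * (- ln r) < r * (1 / r - 1)"
    using assms by (intro mult_strict_left_mono)
  moreover have "r * (1 / r - 1) = 1 - r" using assms by (simp add: right_diff_distrib)
  ultimately show ?thesis by simp
qed

lemma ln_extrap_f_sign:
  assumes "0 \<le> r"
  shows "r < 1 \<Longrightarrow> ln_extrap_f r < 0" and "r > 1 \<Longrightarrow> ln_extrap_f r > 0"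
  using assms entropy_num_pos[of r]
  by (cases "r = 0"; auto simp: ln_extrap_f_def divide_less_0_iff)+

lemma ln_extrap_f_gt: "0 < r \<Longrightarrow> r < 1 \<Longrightarrow> ln_extrap_f 0 < ln_extrap_f r"
  by (simp add: ln_extrap_f_def field_simps mult_pos_neg)

text \<open>The derivative argument works on each side of 1 separately and away from 0. Across 1 the
  sign of \<open>ln_extrap_f\<close> decides; at 0 the value -1 is compared directly.\<close>

lemma extrap_f_strict_mono: "strict_mono_on {0..} extrap_f"
proof (rule strict_mono_onI)
  fix r s :: real assume rs: "r \<in> {0..}" "s \<in> {0..}" "r < s"
  then have "0 \<le> r" "0 < s" by auto
  consider "s < 1" | "s = 1" | "r < 1" "1 < s" | "r = 1" | "1 < r" by linarith
  then show "extrap_f r < extrap_f s"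
  proof cases
    case 1
    then have "ln_extrap_f r < ln_extrap_f s"
      using rs ln_extrap_f_strict_mono_pos[of r s] ln_extrap_f_gt[of s] by (cases "r = 0") auto
    then show ?thesis using 1 rs by (simp add: extrap_f_eq)
  next
    case 2
    then show ?thesis using rs ln_extrap_f_sign(1)[of r] by (simp add: extrap_f_eq)
  next
    case 3
    then have "ln_extrap_f r < ln_extrap_f s"
      using rs ln_extrap_f_sign(1)[of r] ln_extrap_f_sign(2)[of s] by simp
    then show ?thesis using 3 rs by (simp add: extrap_f_eq)
  next
    case 4
    then show ?thesis using rs ln_extrap_f_sign(2)[of s] by (simp add: extrap_f_eq)
  next
    case 5
    then have "ln_extrap_f r < ln_extrap_f s"
      using rs ln_extrap_f_strict_mono_pos[of r s] by auto
    then show ?thesis using 5 rs by (simp add: extrap_f_eq)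
  qed
qed

lemma ln_extrap_f_ivt:
  assumes "0 < a" "a \<le> b" "1 \<notin> {a..b}" "ln_extrap_f a \<le> t" "t \<le> ln_extrap_f b"
  obtains r where "0 < r" "r \<noteq> 1" "ln_extrap_f r = t"
proof -
  have "continuous_on {a..b} ln_extrap_f"
    unfolding ln_extrap_f_def using assms by (intro continuous_intros) auto
  then obtain r where "a \<le> r" "r \<le> b" "ln_extrap_f r = t"
    using IVT'[of ln_extrap_f a t b] assms by blast
  then show thesis using that[of r] assms by auto
qed

text \<open>Intermediate values between explicit brackets on one side of 1, in place of limits at 0,
  1 and infinity. In both cases \<open>1 + t\<close> is the bracket nearer to 1, by ln (1 + t) \<le>
  t.\<close>

lemma ln_extrap_f_surj:
  assumes "-1 < t" "t \<noteq> 0"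
  obtains r where "0 < r" "r \<noteq> 1" "ln_extrap_f r = t"
proof (cases "t > 0")
  case True
  \<comment> \<open>\<open>exp (t + 1)\<close> ensures t + 1 \<le> ln b, hence the upper bound; the
    maximum makes the order of the brackets immediate.\<close>
  define b where "b = max (exp (t + 1)) (1 + t)"
  have b1: "b > 1" using True by (simp add: b_def)
  have "ln (1 + t) \<le> t" using True by (rule ln_add_one_self_le_self[OF less_imp_le])
  then have "(1 + t) * ln (1 + t) \<le> (1 + t) * t" using True by (intro mult_left_mono) auto
  then have lo: "ln_extrap_f (1 + t) \<le> t"
    using True by (simp add: ln_extrap_f_def field_simps)
  have "t + 1 \<le> ln b" using b1 by (subst ln_ge_iff) (auto simp: b_def)
  then have "b * (t + 1) \<le> b * ln b" using b1 by (intro mult_left_mono) auto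
  then have "t * (b - 1) \<le> b * ln b - b + 1" using True by (simp add: algebra_simps)
  then have hi: "t \<le> ln_extrap_f b" using b1 by (simp add: ln_extrap_f_def field_simps)
  show thesis
    using ln_extrap_f_ivt[of "1 + t" b t] that True lo hi by (auto simp: b_def)
next
  case False
  then have t: "t < 0" "t > -1" using assms by auto
  \<comment> \<open>At r = q^2 one has \<open>ln_extrap_f r + 1\<close> = - 2 q^2 ln q / (1 - q^2),
    which the tangent bound at 1/q shows to be at most 2 q. The choice of q turns this bound into 1
    + t.\<close>
  define q where "q = (1 + t) / 2"
  have q: "0 < q" "q < 1" using t by (auto simp: q_def)
  have "ln (1 + t) \<le> t" using ln_le_minus_one[of "1 + t"] t by simp
  then have "(1 + t) * ln (1 + t) \<le> (1 + t) * t" using t by (intro mult_left_mono) auto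
  then have hi: "t \<le> ln_extrap_f (1 + t)"
    using t by (simp add: ln_extrap_f_def field_simps)
  have "- ln q \<le> 1 / q - 1" using ln_le_minus_one[of "1 / q"] q by (simp add: ln_div)
  then have "q\<^sup>2 * (- ln q) \<le> q\<^sup>2 * (1 / q - 1)" by (intro mult_left_mono) auto
  also have "q\<^sup>2 * (1 / q - 1) = q - q\<^sup>2" using q by (simp add: field_simps power2_eq_square)
  finally have 1: "- 2 * q\<^sup>2 * ln q \<le> 2 * (q - q\<^sup>2)" by simp
  have "2 * (q - q\<^sup>2) \<le> 2 * q * (1 - q\<^sup>2)"
    using q power_decreasing[of 2 3 q] by (simp add: algebra_simps power2_eq_square power3_eq_cube)
  then have 2: "- 2 * q\<^sup>2 * ln q \<le> 2 * q * (1 - q\<^sup>2)" using 1 by linarith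
  have "2 * q - 1 = t" by (simp add: q_def field_simps)
  then have "t * (q\<^sup>2 - 1) = (2 * q - 1) * (q\<^sup>2 - 1)" by (simp only:)
  also have "\<dots> = 1 - q\<^sup>2 - 2 * q * (1 - q\<^sup>2)" by (simp add: algebra_simps)
  also have "\<dots> \<le> q\<^sup>2 * (2 * ln q) - q\<^sup>2 + 1" using 2 by linarith
  finally have "t * (q\<^sup>2 - 1) \<le> q\<^sup>2 * (2 * ln q) - q\<^sup>2 + 1" .
  moreover have "q\<^sup>2 - 1 < 0" using q by (simp add: power_less_one_iff)
  ultimately have lo: "ln_extrap_f (q\<^sup>2) \<le> t"
    using q by (simp add: ln_extrap_f_def ln_realpow neg_divide_le_eq)
  have "q\<^sup>2 \<le> 1 + t"
    using q power_decreasing[of 1 2 q] by (simp add: q_def)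
  then show thesis
    using ln_extrap_f_ivt[of "q\<^sup>2" "1 + t" t] that q t lo hi by auto
qed

lemma extrap_f_surj:
  assumes "exp (- 1) < s" obtains r where "0 < r" "extrap_f r = s"
proof (cases "s = 1")
  case False
  have s: "s > 0" using assms by (meson exp_gt_zero order_less_trans)
  moreover have "exp (- 1) < exp (ln s)" using assms s by simp
  ultimately have "- 1 < ln s" "ln s \<noteq> 0" using False by (auto simp only: exp_less_cancel_iff ln_eq_zero_iff)
  then obtain r where "0 < r" "r \<noteq> 1" "ln_extrap_f r = ln s"
    by (rule ln_extrap_f_surj)
  then show thesis using that[of r] s by (simp add: extrap_f_eq)
qed (use that[of 1] in simp)

section \<open>The inverse g and the entropy balance of the extrapolation\<close>

lemma extrap_g_pos:
  assumes "exp (- 1) < s"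
  shows "extrap_g s > 0" "extrap_f (extrap_g s) = s"
proof -
  obtain r where r: "0 < r" "extrap_f r = s" using extrap_f_surj[OF assms] .
  have "extrap_g s = r"
    using assms r strict_mono_on_imp_inj_on[OF extrap_f_strict_mono]
    by (auto simp: extrap_g_def the_inv_into_f_eq)
  then show "extrap_g s > 0" "extrap_f (extrap_g s) = s" using r by auto
qed

lemma extrap_g_nonneg: "extrap_g s \<ge> 0"
  using extrap_g_pos(1)[of s] by (cases "exp (- 1) < s") (auto simp: extrap_g_def)

lemma extrap_nonneg: "a > 0 \<or> c \<ge> 0 \<Longrightarrow> extrap a c \<ge> 0"
  by (auto simp: extrap_def extrap_g_nonneg)

text \<open>A truncated extrapolation is 0, hence below \<open>a\<close>. So a cell that does not
  lose mass is not truncated, and its ratio \<open>c / a\<close> exceeds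
  \<open>exp (- 1)\<close>.\<close>

lemma extrap_ge_imp_pos:
  assumes "a > 0" "extrap a c \<ge> a" shows "c > 0"
proof -
  have "extrap_g (c / a) \<noteq> 0" using assms by (auto simp: extrap_def)
  then have "exp (- 1) < c / a" by (auto simp: extrap_g_def split: if_splits)
  then have "0 < c / a" by (meson exp_gt_zero order_less_trans)
  then show ?thesis using assms(1) by (simp add: zero_less_divide_iff)
qed

text \<open>With new value a r, the entropy increment is a H(r) + a (r - 1) ln a, and f(r) = c / a
  says precisely that H(r) = (r - 1) ln (c / a).\<close>

lemma extrap_scaling_identity:
  assumes "a > 0" "exp (- 1) < c / a"
  shows "entropy_density (extrap a c) - entropy_density a = ln c * (extrap a c - a)"
proof -
  define r where "r = extrap_g (c / a)"
  have r: "r > 0" "extrap_f r = c / a" using extrap_g_pos[OF assms(2)] by (auto simp: r_def)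
  have e: "extrap a c = a * r" using assms by (simp add: extrap_def r_def)
  have c: "c > 0"
    using assms r(2) by (metis exp_gt_zero order_less_trans zero_less_divide_iff order_less_asym)
  show ?thesis
  proof (cases "r = 1")
    case False
    have "ln_extrap_f r = ln (c / a)" using r extrap_f_eq[of r] False by (metis ln_exp order_less_imp_le)
    then have "r * ln r - r + 1 = (ln c - ln a) * (r - 1)"
      using False c assms(1) by (simp add: ln_extrap_f_def ln_div nonzero_divide_eq_eq)
    then have "a * (r * ln r - r + 1) = a * ((ln c - ln a) * (r - 1))" by simp
    then show ?thesis
      using assms(1) r(1) by (simp add: e entropy_density_def ln_mult algebra_simps)
  qed (simp add: e)
qed

text \<open>For a = 0 the value e c is the one making the identity exact. Under truncation the new
  value is 0 and the claim reduces to a ln c \<le> a (ln a - 1); at the threshold c = a / e, which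
  also counts as truncated, this is an equality.\<close>

lemma extrap_entropy_le:
  assumes "a \<ge> 0" "c > 0"
  shows "entropy_density (extrap a c) - entropy_density a \<le> ln c * (extrap a c - a)"
    and "c \<ge> exp (- 1) * a \<Longrightarrow>
      entropy_density (extrap a c) - entropy_density a = ln c * (extrap a c - a)"
proof -
  consider "a = 0" | "a > 0" "exp (- 1) < c / a" | "a > 0" "c / a \<le> exp (- 1)"
    using assms(1) by linarith
  then have "entropy_density (extrap a c) - entropy_density a \<le> ln c * (extrap a c - a) \<and>
    (c \<ge> exp (- 1) * a \<longrightarrow>
      entropy_density (extrap a c) - entropy_density a = ln c * (extrap a c - a))"
  proof cases
    case 1
    then show ?thesis
      using assms(2) by (simp add: extrap_def entropy_density_def ln_mult algebra_simps)
  next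
    case 2
    then show ?thesis using extrap_scaling_identity[of a c] by simp
  next
    case 3
    then have e: "extrap a c = 0" by (simp add: extrap_def extrap_g_def)
    have *: "c \<le> exp (- 1) * a" using 3 by (simp add: field_simps)
    then have "ln c \<le> ln (exp (- 1) * a)" using assms(2) 3 by (subst ln_le_cancel_iff) auto
    also have "\<dots> = ln a - 1" using 3 by (simp add: ln_mult)
    finally have "a * ln c \<le> a * (ln a - 1)" using 3 by (intro mult_left_mono) auto
    then have "a * ln c \<le> a * ln a - a" by (simp add: right_diff_distrib)
    moreover have "a * ln c = a * ln a - a" if "c \<ge> exp (- 1) * a"
    proof -
      have "c = exp (- 1) * a" using * that by simp
      then have "ln c = ln a - 1" using 3 by (simp add: ln_mult)
      then show ?thesis by (simp add: right_diff_distrib)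
    qed
    ultimately show ?thesis
      using 3 by (auto simp: e entropy_density_def mult.commute)
  qed
  then show "entropy_density (extrap a c) - entropy_density a \<le> ln c * (extrap a c - a)"
    and "c \<ge> exp (- 1) * a \<Longrightarrow>
      entropy_density (extrap a c) - entropy_density a = ln c * (extrap a c - a)" by auto
qed

section \<open>The dissipation potentials and the dissipation on one facet\<close>

lemma psi_minus: "psi (- z) = psi z"
  by (simp add: psi_def arsinh_minus_real)

lemma psi_abs: "psi \<bar>z\<bar> = psi z"
  by (cases "z \<ge> 0") (auto simp: psi_minus)

text \<open>Equality in the Fenchel-Young inequality for \<open>psi\<close> and \<open>psi_star\<close>.\<close>

lemma psi_sinh_add_psi_star: "psi (2 * sinh (\<xi> / 2)) + psi_star \<xi> = 2 * sinh (\<xi> / 2) * \<xi>"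
proof -
  have "4 + (2 * sinh (\<xi> / 2))\<^sup>2 = (2 * cosh (\<xi> / 2))\<^sup>2"
    by (simp add: cosh_square_eq power_mult_distrib)
  then have "sqrt (4 + (2 * sinh (\<xi> / 2))\<^sup>2) = 2 * cosh (\<xi> / 2)"
    by (simp only: real_sqrt_abs) simp
  then show ?thesis by (simp add: psi_def psi_star_def arsinh_sinh_real)
qed

lemma two_sinh_half_ln:
  fixes u v :: real
  assumes "u > 0" "v > 0"
  shows "2 * sinh ((ln u - ln v) / 2) = (u - v) / sqrt (u * v)"
proof -
  have "exp ((ln u - ln v) / 2) = sqrt u / sqrt v"
    using assms by (simp add: diff_divide_distrib exp_diff flip: ln_sqrt)
  moreover have "exp (- ((ln u - ln v) / 2)) = sqrt v / sqrt u"
    using assms by (simp add: diff_divide_distrib exp_diff flip: ln_sqrt)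
  ultimately have "2 * sinh ((ln u - ln v) / 2) = sqrt u / sqrt v - sqrt v / sqrt u"
    by (simp only: sinh_field_def) (simp add: mult.commute)
  also have "\<dots> = (sqrt u * sqrt u - sqrt v * sqrt v) / (sqrt u * sqrt v)"
    using assms by (simp add: field_simps)
  finally show ?thesis using assms by (simp add: real_sqrt_mult)
qed

text \<open>The weight sqrt (p q) cancels against sqrt (s t / (p q)), so d F / r = 2 sinh (\<xi> /
  2) and the equality case of Fenchel-Young applies. If s = t = 0, both sides vanish under division
  by zero. If only one of them is 0, the left side vanishes while the right side need not.\<close>

lemma facet_dissipation_identity:
  fixes p q s t d :: real
  assumes "p > 0" "q > 0" "d > 0" and st: "s > 0 \<and> t > 0 \<or> s = 0 \<and> t = 0"
  defines "F \<equiv> sqrt (p * q) / d * (s / p - t / q)" and "r \<equiv> sqrt (s * t)"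
    and "\<xi> \<equiv> ln (s / p) - ln (t / q)"
  shows "r / d * psi (d * \<bar>F\<bar> / r) + r / d * psi_star \<xi> = F * \<xi>"
proof (cases "s = 0")
  case False
  then have pos: "s > 0" "t > 0" using st by auto
  define z where "z = 2 * sinh (\<xi> / 2)"
  have z: "z = (s / p - t / q) / sqrt (s / p * (t / q))"
    unfolding z_def \<xi>_def using pos assms(1,2) by (intro two_sinh_half_ln) auto
  have "sqrt (s / p * (t / q)) = r / sqrt (p * q)"
    by (simp add: r_def real_sqrt_divide)
  then have F: "F = r / d * z"
    using pos assms(1-3) by (simp add: z F_def r_def)
  then have "d * F / r = z" using pos assms(3) by (simp add: r_def)
  moreover have "\<bar>d * F / r\<bar> = d * \<bar>F\<bar> / r" using pos assms(3) by (simp add: r_def abs_mult)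
  ultimately have "psi (d * \<bar>F\<bar> / r) = psi z" using psi_abs[of z] by simp
  then have "r / d * psi (d * \<bar>F\<bar> / r) + r / d * psi_star \<xi> = r / d * (psi z + psi_star \<xi>)"
    by (simp add: distrib_left)
  also have "\<dots> = r / d * (z * \<xi>)"
    unfolding z_def by (simp only: psi_sinh_add_psi_star)
  finally show ?thesis using F by simp
qed (use st in \<open>simp add: F_def r_def\<close>)

section \<open>Geometry of admissible meshes\<close>

text \<open>\<open>H\<close> lists the bounding hyperplanes of all half-spaces involved. A connected
  set avoiding them stays on one side of each, so it cannot leave a polyhedron that it meets; being
  open, it then lies in the interior of the union.\<close>

lemma open_polyhedron_arrangement:
  fixes K :: "'a::euclidean_space set"
  assumes "open_polyhedron K"
  obtains H where "finite H" "\<And>c e. (c, e) \<in> H \<Longrightarrow> c \<noteq> 0"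
    "\<And>C. open C \<Longrightarrow> connected C \<Longrightarrow> (\<And>c e x. (c, e) \<in> H \<Longrightarrow> x \<in> C \<Longrightarrow> c \<bullet> x \<noteq> e) \<Longrightarrow>
       C \<inter> K \<noteq> {} \<Longrightarrow> C \<subseteq> K"
proof -
  obtain Ps where Ps: "finite Ps" "\<And>P. P \<in> Ps \<Longrightarrow> polyhedron P" "K = interior (\<Union>Ps)"
    using assms unfolding open_polyhedron_def by blast
  have "\<exists>F. finite F \<and> P = \<Inter>F \<and> (\<forall>h\<in>F. \<exists>a b. a \<noteq> 0 \<and> h = {x. a \<bullet> x \<le> b})" if "P \<in> Ps" for P
    using Ps(2)[OF that] unfolding polyhedron_def .
  then obtain F where F: "\<And>P. P \<in> Ps \<Longrightarrow> finite (F P)" "\<And>P. P \<in> Ps \<Longrightarrow> P = \<Inter>(F P)"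
      "\<And>P h. P \<in> Ps \<Longrightarrow> h \<in> F P \<Longrightarrow> \<exists>a b. a \<noteq> 0 \<and> h = {x. a \<bullet> x \<le> b}"
    by metis
  have "\<forall>h\<in>\<Union>(F ` Ps). \<exists>p. fst p \<noteq> 0 \<and> (\<forall>x. x \<in> h \<longleftrightarrow> fst p \<bullet> x \<le> (snd p :: real))"
  proof
    fix h assume "h \<in> \<Union>(F ` Ps)"
    then obtain a b where "a \<noteq> 0 \<and> h = {x. a \<bullet> x \<le> b}" using F(3) by blast
    then show "\<exists>p. fst p \<noteq> 0 \<and> (\<forall>x. x \<in> h \<longleftrightarrow> fst p \<bullet> x \<le> (snd p :: real))"
      by (intro exI[of _ "(a, b)"]) simp
  qed
  then obtain g where g: "\<forall>h\<in>\<Union>(F ` Ps). fst (g h) \<noteq> 0 \<and> (\<forall>x. x \<in> h \<longleftrightarrow> fst (g h) \<bullet> x \<le> (snd (g h) :: real))"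
    by (rule bchoice[THEN exE])
  define n where "n = (\<lambda>h. fst (g h))"
  define d where "d = (\<lambda>h. snd (g h))"
  have nd: "n h \<noteq> 0" "x \<in> h \<longleftrightarrow> n h \<bullet> x \<le> d h" if "P \<in> Ps" "h \<in> F P" for P h x
    using g that unfolding n_def d_def by auto
  show thesis
  proof (rule that[of "\<Union>P\<in>Ps. (\<lambda>h. (n h, d h)) ` F P"])
    show "finite (\<Union>P\<in>Ps. (\<lambda>h. (n h, d h)) ` F P)" using Ps(1) F(1) by blast
    show "c \<noteq> 0" if "(c, e) \<in> (\<Union>P\<in>Ps. (\<lambda>h. (n h, d h)) ` F P)" for c e
      using that by (auto simp: nd(1))
  next
    fix C assume C: "open C" "connected C"
      and avoid: "\<And>c e x. (c, e) \<in> (\<Union>P\<in>Ps. (\<lambda>h. (n h, d h)) ` F P) \<Longrightarrow> x \<in> C \<Longrightarrow> c \<bullet> x \<noteq> e"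
      and "C \<inter> K \<noteq> {}"
    then obtain x where x: "x \<in> C" "x \<in> K" by blast
    then have "x \<in> \<Union>Ps" unfolding Ps(3) using interior_subset by blast
    then obtain P where P: "P \<in> Ps" "x \<in> P" by blast
    have "C \<subseteq> P"
    proof
      fix y assume y: "y \<in> C"
      have "y \<in> h" if h: "h \<in> F P" for h
      proof (rule ccontr)
        assume "y \<notin> h"
        have "x \<in> h" using P F(2)[OF P(1)] h by blast
        then have "n h \<bullet> x \<le> d h" "d h \<le> n h \<bullet> y" using \<open>y \<notin> h\<close> nd(2)[OF P(1) h] by auto
        then obtain z where "z \<in> C" "n h \<bullet> z = d h"
          using connected_ivt_hyperplane[OF C(2) x(1) y] by blast
        then show False using avoid[of "n h" "d h" z] P(1) h by blast
      qed
      then have "y \<in> \<Inter>(F P)" by blast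
      with F(2)[OF P(1), symmetric] show "y \<in> P" by (rule subst[where P = "\<lambda>S. y \<in> S"])
    qed
    then show "C \<subseteq> K" unfolding Ps(3) using P(1) by (intro interior_maximal C(1)) blast
  qed
qed

lemma open_polyhedron_open: "open_polyhedron K \<Longrightarrow> open K"
  by (auto simp: open_polyhedron_def)

lemma open_meets_off_hyperplane:
  fixes G :: "'a::euclidean_space set"
  assumes "open G" "G \<noteq> {}" "a \<noteq> 0"
  obtains x where "x \<in> G" "a \<bullet> x \<noteq> b"
proof (rule ccontr)
  assume "\<not> thesis"
  then have "G \<subseteq> {x. a \<bullet> x = b}" using that by blast
  then have "G \<subseteq> interior {x. a \<bullet> x = b}" using assms(1) by (intro interior_maximal)
  then show False using assms(2,3) by simp
qed

text \<open>A proper inclusion of affine sets would raise the dimension strictly.\<close>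

lemma hyperplane_subset_imp_eq:
  fixes a c :: "'a::euclidean_space"
  assumes "a \<noteq> 0" "c \<noteq> 0" "{x. a \<bullet> x = b} \<subseteq> {x. c \<bullet> x = e}"
  shows "{x. a \<bullet> x = b} = {x. c \<bullet> x = e}"
proof (rule ccontr)
  assume "{x. a \<bullet> x = b} \<noteq> {x. c \<bullet> x = e}"
  then have "affine hull {x. a \<bullet> x = b} \<subset> affine hull {x. c \<bullet> x = e}"
    using assms(3) by (simp add: affine_hyperplane hull_same psubset_eq)
  from aff_dim_psubset[OF this] show False using assms by simp
qed

text \<open>Off the intersections with transversal hyperplanes of the two arrangements, a small ball
  around y is cut at most by the hyperplane of the facet. Each open half-ball then lies in any of
  the two cells that it meets.\<close>

lemma interface_almost_everywhere_two_sided: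
  fixes K L :: "'a::euclidean_space set"
  assumes K: "open_polyhedron K" and L: "open_polyhedron L" and disj: "K \<inter> L = {}"
    and sub: "interface K L \<subseteq> {x. a \<bullet> x = b}" and a: "a \<noteq> 0" and bdd: "bounded (interface K L)"
  obtains Z where "hausdorff_measure (DIM('a) - 1) Z = 0"
    "\<And>y. y \<in> interface K L - Z \<Longrightarrow> \<exists>r>0. ball y r - {x. a \<bullet> x = b} \<subseteq> K \<union> L"
proof -
  obtain H1 where H1: "finite H1" "\<And>c e. (c, e) \<in> H1 \<Longrightarrow> c \<noteq> 0"
    "\<And>C. open C \<Longrightarrow> connected C \<Longrightarrow> (\<And>c e x. (c, e) \<in> H1 \<Longrightarrow> x \<in> C \<Longrightarrow> c \<bullet> x \<noteq> e) \<Longrightarrow>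
       C \<inter> K \<noteq> {} \<Longrightarrow> C \<subseteq> K"
    using open_polyhedron_arrangement[OF K] by metis
  obtain H2 where H2: "finite H2" "\<And>c e. (c, e) \<in> H2 \<Longrightarrow> c \<noteq> 0"
    "\<And>C. open C \<Longrightarrow> connected C \<Longrightarrow> (\<And>c e x. (c, e) \<in> H2 \<Longrightarrow> x \<in> C \<Longrightarrow> c \<bullet> x \<noteq> e) \<Longrightarrow>
       C \<inter> L \<noteq> {} \<Longrightarrow> C \<subseteq> L"
    using open_polyhedron_arrangement[OF L] by metis
  define H where "H = H1 \<union> H2"
  have finH: "finite H" using H1 H2 by (simp add: H_def)
  define A where "A = {x. a \<bullet> x = b}"
  \<comment> \<open>Hyperplanes containing \<open>A\<close> coincide with it and cut nothing
    further. Each of the others meets \<open>A\<close> in a flat of smaller dimension, possibly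
    empty, hence in a null set on the bounded interface.\<close>
  define J where "J = {p \<in> H. \<not> A \<subseteq> {x. fst p \<bullet> x = snd p}}"
  define Z where "Z = (\<Union>p\<in>J. interface K L \<inter> {x. fst p \<bullet> x = snd p})"
  show thesis
  proof
    show "hausdorff_measure (DIM('a) - 1) Z = 0"
      unfolding Z_def
    proof (rule hausdorff_null_UN)
      show "countable J" using finH by (simp add: J_def countable_finite)
    next
      fix p assume p: "p \<in> J"
      let ?E = "{x. fst p \<bullet> x = snd p}"
      have "A \<inter> ?E \<subset> A" using p by (auto simp: J_def)
      then have "affine hull (A \<inter> ?E) \<subset> affine hull A"
        unfolding A_def by (simp add: affine_hyperplane affine_Int hull_same)
      then have "aff_dim (A \<inter> ?E) < aff_dim A" by (rule aff_dim_psubset)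
      also have "aff_dim A = int (DIM('a) - 1)"
        using a by (simp add: A_def of_nat_diff)
      finally have "aff_dim (A \<inter> ?E) < int (DIM('a) - 1)" .
      moreover have "aff_dim (interface K L \<inter> ?E) \<le> aff_dim (A \<inter> ?E)"
        using sub by (intro aff_dim_subset) (auto simp: A_def)
      moreover have "bounded (interface K L \<inter> ?E)" using bdd by (rule bounded_subset) blast
      ultimately show "hausdorff_measure (DIM('a) - 1) (interface K L \<inter> ?E) = 0"
        by (intro hausdorff_null_aff_dim) auto
    qed
  next
    fix y assume y: "y \<in> interface K L - Z"
    \<comment> \<open>A neighbourhood of y clear of all hyperplanes that miss y; those through y
      must equal \<open>A\<close> because y is not in \<open>Z\<close>.\<close>
    define G where "G = (\<Inter>p\<in>{p \<in> H. fst p \<bullet> y \<noteq> snd p}. {x. fst p \<bullet> x \<noteq> snd p})"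
    have "open G" unfolding G_def
      using finH by (intro open_INT) (auto intro!: open_Collect_neq continuous_intros)
    moreover have "y \<in> G" by (auto simp: G_def)
    ultimately obtain r where r: "r > 0" "ball y r \<subseteq> G" by (meson openE)
    have avoid: "c \<bullet> x \<noteq> e" if "x \<in> ball y r" "x \<notin> A" "(c, e) \<in> H" for c e x
    proof (cases "c \<bullet> y = e")
      case True
      have "A \<subseteq> {x. c \<bullet> x = e}"
      proof (rule ccontr)
        assume "\<not> A \<subseteq> {x. c \<bullet> x = e}"
        then have "(c, e) \<in> J" using that(3) by (simp add: J_def)
        then have "y \<in> Z" using True y by (auto simp: Z_def)
        then show False using y by blast
      qed
      moreover have "c \<noteq> 0" using that(3) H1(2) H2(2) by (auto simp: H_def)
      ultimately have "A = {x. c \<bullet> x = e}"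
        using hyperplane_subset_imp_eq[OF a] by (simp add: A_def)
      then show ?thesis using that(2) by blast
    next
      case False
      moreover have "x \<in> G" using that(1) r(2) by blast
      ultimately show ?thesis using that(3) by (auto simp: G_def)
    qed
    define Cm where "Cm = ball y r \<inter> {x. a \<bullet> x < b}"
    define Cp where "Cp = ball y r \<inter> {x. a \<bullet> x > b}"
    have op: "open Cm" "open Cp"
      unfolding Cm_def Cp_def by (auto intro: open_halfspace_lt open_halfspace_gt)
    have con: "connected Cm" "connected Cp"
      unfolding Cm_def Cp_def
      by (auto intro!: convex_connected convex_Int convex_halfspace_lt convex_halfspace_gt)
    have split: "ball y r - A = Cm \<union> Cp" by (auto simp: Cm_def Cp_def A_def)
    have mA: "x \<notin> A" "x \<in> ball y r" if "x \<in> Cm \<or> x \<in> Cp" for x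
      using that by (auto simp: Cm_def Cp_def A_def)
    have meets: "M \<inter> Cm \<noteq> {} \<or> M \<inter> Cp \<noteq> {}" if M: "open M" "y \<in> frontier M" for M
    proof -
      have "M \<inter> ball y r \<noteq> {}"
        using M(2) r(1) open_Int_closure_eq_empty[of "ball y r" M] centre_in_ball[of y r]
        unfolding frontier_def by blast
      then obtain x where "x \<in> M \<inter> ball y r" "a \<bullet> x \<noteq> b"
        using open_meets_off_hyperplane[of "M \<inter> ball y r" a b] M(1) a by blast
      then show ?thesis by (auto simp: Cm_def Cp_def not_less_iff_gr_or_eq neq_iff)
    qed
    have yf: "y \<in> frontier K" "y \<in> frontier L" using y by (auto simp: interface_def)
    have avoid': "c \<bullet> x \<noteq> e" if "C = Cm \<or> C = Cp" "x \<in> C" "(c, e) \<in> H" for C c e x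
      using that mA by (intro avoid) auto
    have K1: "C \<subseteq> K" if "C = Cm \<or> C = Cp" "C \<inter> K \<noteq> {}" for C
      using that op con avoid' by (intro H1(3)) (auto simp: H_def)
    have L1: "C \<subseteq> L" if "C = Cm \<or> C = Cp" "C \<inter> L \<noteq> {}" for C
      using that op con avoid' by (intro H2(3)) (auto simp: H_def)
    \<comment> \<open>Each cell has y on its frontier, so it meets and hence contains a half-ball.
      Disjointness gives the two cells different halves.\<close>
    have "Cm \<union> Cp \<subseteq> K \<union> L"
      using meets[OF open_polyhedron_open[OF K] yf(1)] meets[OF open_polyhedron_open[OF L] yf(2)]
        K1[of Cm] K1[of Cp] L1[of Cm] L1[of Cp] disj by blast
    then have "ball y r - A \<subseteq> K \<union> L" using split by simp
    then show "\<exists>r>0. ball y r - {x. a \<bullet> x = b} \<subseteq> K \<union> L" using r(1) unfolding A_def by blast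
  qed
qed

lemma ball_off_hyperplane_not_closure:
  fixes y :: "'a::euclidean_space"
  assumes "ball y r - {x. a \<bullet> x = b} \<subseteq> S" "r > 0" "a \<noteq> 0" "open M" "M \<inter> S = {}"
  shows "y \<notin> closure M"
proof
  assume "y \<in> closure M"
  then have "M \<inter> ball y r \<noteq> {}"
    using assms(2) open_Int_closure_eq_empty[of "ball y r" M] centre_in_ball[of y r] by blast
  then obtain x where "x \<in> M \<inter> ball y r" "a \<bullet> x \<noteq> b"
    using open_meets_off_hyperplane[of "M \<inter> ball y r" a b] assms(3,4) by blast
  then show False using assms(1,5) by blast
qed

text \<open>The centre is the midpoint of two points of the ball on opposite sides of the
  hyperplane. With convexity of the domain this shows that almost every point of an interior facet
  lies in \<Omega>.\<close>

lemma ball_off_hyperplane_convex: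
  fixes y :: "'a::euclidean_space"
  assumes "ball y r - {x. a \<bullet> x = b} \<subseteq> S" "r > 0" "a \<noteq> 0" "a \<bullet> y = b" "convex S"
  shows "y \<in> S"
proof -
  define t where "t = r / (2 * norm a)"
  have t: "t > 0" using assms by (simp add: t_def)
  have *: "y + s *\<^sub>R a \<in> S" if "\<bar>s\<bar> = t" for s
  proof -
    have "norm (s *\<^sub>R a) = r / 2" using that assms(3) by (simp add: t_def)
    then have "y + s *\<^sub>R a \<in> ball y r" using assms(2) by (simp add: dist_norm)
    moreover have "a \<bullet> (y + s *\<^sub>R a) \<noteq> b" using assms(3,4) that t by (auto simp: inner_add_right)
    ultimately show ?thesis using assms(1) by blast
  qed
  have "(1/2) *\<^sub>R (y + t *\<^sub>R a) + (1/2) *\<^sub>R (y + (- t) *\<^sub>R a) \<in> S"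
    using *[of t] *[of "- t"] t by (intro convexD[OF assms(5)]) auto
  moreover have "(1/2) *\<^sub>R (y + t *\<^sub>R a) + (1/2) *\<^sub>R (y + (- t) *\<^sub>R a) = y"
    by (simp add: scaleR_right_distrib scaleR_right_diff_distrib flip: scaleR_left_distrib)
  ultimately show ?thesis by simp
qed

section \<open>Incidence of facets and cells in an admissible mesh\<close>

context
  fixes \<Omega> :: "'a::euclidean_space set" and m :: "'a mesh"
  assumes domain: "open \<Omega>" "bounded \<Omega>" "convex \<Omega>"
    and mesh: "admissible_mesh \<Omega> m"
begin

lemma mesh_finite_cells: "finite (cells m)"
  using mesh by (simp add: admissible_mesh_def)

lemma mesh_open_polyhedron: "K \<in> cells m \<Longrightarrow> open_polyhedron K"
  using mesh by (simp add: admissible_mesh_def)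

lemma mesh_open_cell: "K \<in> cells m \<Longrightarrow> open K"
  by (rule open_polyhedron_open[OF mesh_open_polyhedron])

lemma mesh_vol_pos: "K \<in> cells m \<Longrightarrow> 0 < vol K"
  using mesh by (simp add: admissible_mesh_def)

lemma mesh_cells_disjoint: "K \<in> cells m \<Longrightarrow> L \<in> cells m \<Longrightarrow> K \<noteq> L \<Longrightarrow> K \<inter> L = {}"
proof -
  have "pairwise disjnt (cells m)" using mesh by (simp add: admissible_mesh_def)
  then show "K \<in> cells m \<Longrightarrow> L \<in> cells m \<Longrightarrow> K \<noteq> L \<Longrightarrow> K \<inter> L = {}"
    unfolding pairwise_def disjnt_def by blast
qed

text \<open>The cells are only known to lie in the closure of the domain; for an open convex set the
  interior of the closure is the set itself.\<close>

lemma mesh_cell_subset: assumes "K \<in> cells m" shows "K \<subseteq> \<Omega>"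
proof -
  have "(\<Union>K\<in>cells m. closure K) = closure \<Omega>"
    using mesh by (simp add: admissible_mesh_def)
  then have "K \<subseteq> closure \<Omega>" using assms closure_subset by blast
  then have "K \<subseteq> interior (closure \<Omega>)" using mesh_open_cell[OF assms] by (rule interior_maximal)
  then show ?thesis using domain by (simp add: convex_interior_closure interior_open)
qed

lemma mesh_facet_props:
  "\<forall>\<sigma>\<in>facets m. closed \<sigma> \<and> \<sigma> \<subseteq> closure \<Omega> \<and>
     (\<exists>a b. a \<noteq> 0 \<and> \<sigma> \<subseteq> {x. a \<bullet> x = b}) \<and> 0 < area \<sigma> \<and>
     (\<sigma> \<in> interior_facets m \<or> (\<exists>K\<in>cells m. \<sigma> \<subseteq> frontier K \<inter> frontier \<Omega>))"
  using mesh unfolding admissible_mesh_def by (elim conjE)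

lemma mesh_facet_hyperplane:
  assumes "\<sigma> \<in> facets m" obtains a b where "a \<noteq> 0" "\<sigma> \<subseteq> {x. a \<bullet> x = b}"
  using bspec[OF mesh_facet_props assms] by blast

lemma mesh_facet_bounded: assumes "\<sigma> \<in> facets m" shows "bounded \<sigma>"
proof -
  have "\<sigma> \<subseteq> closure \<Omega>" using bspec[OF mesh_facet_props assms] by blast
  then show ?thesis using domain(2) by (meson bounded_closure bounded_subset)
qed

lemma mesh_area_pos: "\<sigma> \<in> facets m \<Longrightarrow> 0 < area \<sigma>"
  using bspec[OF mesh_facet_props] by blast

lemma mesh_facet_cases:
  assumes "\<sigma> \<in> facets m"
  obtains "\<sigma> \<in> interior_facets m" | "\<sigma> \<subseteq> frontier \<Omega>"
  using bspec[OF mesh_facet_props assms] by blast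

lemma mesh_facets_of:
  "\<forall>K\<in>cells m. facets_of m K \<subseteq> facets m \<and> frontier K = \<Union>(facets_of m K)"
  using mesh unfolding admissible_mesh_def by (elim conjE)

lemma mesh_frontier: "K \<in> cells m \<Longrightarrow> frontier K = \<Union>(facets_of m K)"
  using mesh_facets_of by simp

lemma mesh_facets_of_subset: "K \<in> cells m \<Longrightarrow> facets_of m K \<subseteq> facets m"
  using mesh_facets_of by simp

lemma mesh_facets_Int_null:
  assumes "\<sigma> \<in> facets m" "\<sigma>' \<in> facets m" "\<sigma> \<noteq> \<sigma>'"
  shows "hausdorff_measure (DIM('a) - 1) (\<sigma> \<inter> \<sigma>') = 0"
proof -
  have "\<forall>\<sigma>\<in>facets m. \<forall>\<sigma>'\<in>facets m. \<sigma> \<noteq> \<sigma>' \<longrightarrow>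
      hausdorff_measure (DIM('a) - 1) (\<sigma> \<inter> \<sigma>') = 0"
    using mesh unfolding admissible_mesh_def by (elim conjE)
  then show ?thesis using assms by blast
qed

lemma mesh_center_inj: "K \<in> cells m \<Longrightarrow> L \<in> cells m \<Longrightarrow> center m K = center m L \<longleftrightarrow> K = L"
  using mesh by (simp add: admissible_mesh_def)

text \<open>Finiteness is stated for cells only; interior facets inherit it as images of pairs of
  cells.\<close>

lemma mesh_finite_interior_facets: "finite (interior_facets m)"
proof -
  have "interior_facets m \<subseteq> (\<lambda>(K, L). interface K L) ` (cells m \<times> cells m)"
    by (auto simp: interior_facets_def)
  then show ?thesis
    by (rule finite_subset) (intro finite_imageI finite_cartesian_product mesh_finite_cells)
qed

text \<open>Near almost every point the two cells fill a ball up to the hyperplane. Convexity then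
  puts the point inside \<Omega>, and a third open cell, disjoint from both, finds no room
  nearby.\<close>

lemma mesh_facet_two_sided:
  assumes K: "K \<in> cells m" and L: "L \<in> cells m" and KL: "K \<noteq> L" and fac: "interface K L \<in> facets m"
  obtains Z where "hausdorff_measure (DIM('a) - 1) Z = 0"
    "\<And>y. y \<in> interface K L - Z \<Longrightarrow> y \<in> \<Omega>"
    "\<And>y M. y \<in> interface K L - Z \<Longrightarrow> M \<in> cells m \<Longrightarrow> y \<in> frontier M \<Longrightarrow> M = K \<or> M = L"
proof -
  obtain a b where ab: "a \<noteq> 0" "interface K L \<subseteq> {x. a \<bullet> x = b}"
    using mesh_facet_hyperplane[OF fac] by blast
  obtain Z where Z: "hausdorff_measure (DIM('a) - 1) Z = 0"
    "\<And>y. y \<in> interface K L - Z \<Longrightarrow> \<exists>r>0. ball y r - {x. a \<bullet> x = b} \<subseteq> K \<union> L"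
    using interface_almost_everywhere_two_sided[OF mesh_open_polyhedron[OF K]
        mesh_open_polyhedron[OF L] mesh_cells_disjoint[OF K L KL] ab(2,1) mesh_facet_bounded[OF fac]]
    by blast
  show thesis
  proof
    fix y assume y: "y \<in> interface K L - Z"
    then obtain r where r: "r > 0" "ball y r - {x. a \<bullet> x = b} \<subseteq> K \<union> L" using Z(2) by blast
    have "ball y r - {x. a \<bullet> x = b} \<subseteq> \<Omega>" using r(2) mesh_cell_subset K L by blast
    then show "y \<in> \<Omega>"
      using r(1) ab y domain(3) by (intro ball_off_hyperplane_convex) auto
    fix M assume M: "M \<in> cells m" "y \<in> frontier M"
    show "M = K \<or> M = L"
    proof (rule ccontr)
      assume "\<not> (M = K \<or> M = L)"
      then have "M \<inter> (K \<union> L) = {}" using mesh_cells_disjoint M(1) K L by blast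
      then have "y \<notin> closure M"
        using ball_off_hyperplane_not_closure[OF r(2,1) ab(1) mesh_open_cell[OF M(1)]] by blast
      then show False using M(2) by (simp add: frontier_def)
    qed
  qed (rule Z(1))
qed

lemma mesh_not_null_facet:
  "\<sigma> \<in> facets m \<Longrightarrow> hausdorff_measure (DIM('a) - 1) Z = 0 \<Longrightarrow> \<exists>y. y \<in> \<sigma> - Z"
  using area_null[OF mesh_area_pos] hausdorff_null_subset by blast

lemma mesh_facet_frontier_iff:
  assumes K: "K \<in> cells m" and L: "L \<in> cells m" and KL: "K \<noteq> L" and fac: "interface K L \<in> facets m"
    and M: "M \<in> cells m"
  shows "interface K L \<subseteq> frontier M \<longleftrightarrow> M = K \<or> M = L"
proof
  assume sub: "interface K L \<subseteq> frontier M"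
  obtain Z where Z: "hausdorff_measure (DIM('a) - 1) Z = 0"
    "\<And>y M. y \<in> interface K L - Z \<Longrightarrow> M \<in> cells m \<Longrightarrow> y \<in> frontier M \<Longrightarrow> M = K \<or> M = L"
    using mesh_facet_two_sided[OF K L KL fac] by metis
  obtain y where "y \<in> interface K L - Z" using mesh_not_null_facet[OF fac Z(1)] by blast
  then show "M = K \<or> M = L" using Z(2)[of y M] M sub by blast
qed (auto simp: interface_def)

text \<open>If the facet were missing from the list of one of its cells, the listed facets would
  still have to cover it, as they cover the whole frontier of that cell. Interior ones meet it in
  null sets, and boundary ones lie in the frontier of \<Omega>, which misses almost all of
  it.\<close>

lemma mesh_facets_of_iff:
  assumes K: "K \<in> cells m" and L: "L \<in> cells m" and KL: "K \<noteq> L" and fac: "interface K L \<in> facets m"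
    and M: "M \<in> cells m"
  shows "interface K L \<in> facets_of m M \<longleftrightarrow> M = K \<or> M = L"
proof
  assume "interface K L \<in> facets_of m M"
  then have "interface K L \<subseteq> frontier M" using mesh_frontier[OF M] by blast
  then show "M = K \<or> M = L" using mesh_facet_frontier_iff[OF assms] by simp
next
  assume MKL: "M = K \<or> M = L"
  let ?\<sigma> = "interface K L"
  show "?\<sigma> \<in> facets_of m M"
  proof (rule ccontr)
    assume notin: "?\<sigma> \<notin> facets_of m M"
    obtain Z where Z: "hausdorff_measure (DIM('a) - 1) Z = 0" "\<And>y. y \<in> ?\<sigma> - Z \<Longrightarrow> y \<in> \<Omega>"
      using mesh_facet_two_sided[OF K L KL fac] by metis
    define Y where "Y = (\<Union>\<sigma>'\<in>facets_of m M \<inter> interior_facets m. ?\<sigma> \<inter> \<sigma>')"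
    have "hausdorff_measure (DIM('a) - 1) Y = 0"
      unfolding Y_def
    proof (rule hausdorff_null_UN)
      show "countable (facets_of m M \<inter> interior_facets m)"
        using mesh_finite_interior_facets by (simp add: countable_finite)
    next
      fix \<sigma>' assume "\<sigma>' \<in> facets_of m M \<inter> interior_facets m"
      then show "hausdorff_measure (DIM('a) - 1) (?\<sigma> \<inter> \<sigma>') = 0"
        using notin mesh_facets_of_subset[OF M] fac by (intro mesh_facets_Int_null) auto
    qed
    then have "hausdorff_measure (DIM('a) - 1) (Z \<union> Y) = 0"
      using Z(1) by (intro hausdorff_null_Un)
    then obtain y where y: "y \<in> ?\<sigma>" "y \<notin> Z" "y \<notin> Y"
      using mesh_not_null_facet[OF fac] by blast
    have "y \<in> frontier M" using y(1) MKL by (auto simp: interface_def)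
    then obtain \<sigma>' where \<sigma>': "\<sigma>' \<in> facets_of m M" "y \<in> \<sigma>'" using mesh_frontier[OF M] by blast
    then have "\<sigma>' \<notin> interior_facets m" using y by (auto simp: Y_def)
    then have "\<sigma>' \<subseteq> frontier \<Omega>"
      using mesh_facet_cases[of \<sigma>'] \<sigma>'(1) mesh_facets_of_subset[OF M] by blast
    then have "y \<in> frontier \<Omega>" using \<sigma>'(2) by blast
    moreover have "y \<in> \<Omega>" using Z(2) y by blast
    ultimately show False using domain(1) by (simp add: frontier_def interior_open)
  qed
qed

lemma mesh_neighbour:
  assumes "K \<in> cells m" "L \<in> cells m" "K \<noteq> L" "interface K L \<in> facets m"
  shows "neighbour m K (interface K L) = L"
  unfolding neighbour_def
proof (rule the_equality)
  fix L' assume L': "L' \<in> cells m \<and> K \<noteq> L' \<and> interface K L = interface K L'"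
  then have "interface K L \<subseteq> frontier L'" by (simp add: interface_def)
  then show "L' = L" using mesh_facet_frontier_iff[OF assms, of L'] L' by auto
qed (use assms in simp)

text \<open>Collects what the sums need: the arbitrary choice in \<open>facet_cells\<close> and the
  description in \<open>neighbour\<close> agree, and exactly two cells list the facet.\<close>

lemma mesh_interior_facetE:
  assumes "\<sigma> \<in> interior_facets m"
  obtains K L where "facet_cells m \<sigma> = (K, L)" "K \<in> cells m" "L \<in> cells m" "K \<noteq> L"
    "neighbour m K \<sigma> = L" "neighbour m L \<sigma> = K" "0 < facet_dist m \<sigma>" "0 < area \<sigma>"
    "{M \<in> cells m. \<sigma> \<in> interior_facets_of m M} = {K, L}"
proof -
  obtain K L where KL: "facet_cells m \<sigma> = (K, L)" by (cases "facet_cells m \<sigma>")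
  have "\<exists>p. case p of (K, L) \<Rightarrow> K \<in> cells m \<and> L \<in> cells m \<and> K \<noteq> L \<and> \<sigma> = interface K L"
    using assms by (auto simp: interior_facets_def)
  then have "case facet_cells m \<sigma> of (K, L) \<Rightarrow> K \<in> cells m \<and> L \<in> cells m \<and> K \<noteq> L \<and> \<sigma> = interface K L"
    unfolding facet_cells_def by (rule someI_ex)
  then have c: "K \<in> cells m" "L \<in> cells m" "K \<noteq> L" and \<sigma>: "\<sigma> = interface K L"
    by (simp_all add: KL)
  have \<sigma>': "\<sigma> = interface L K" using \<sigma> by (simp add: interface_def Int_commute)
  have fac: "\<sigma> \<in> facets m" using assms by (simp add: interior_facets_def)
  show thesis
  proof (rule that[OF KL c])
    show "neighbour m K \<sigma> = L" using mesh_neighbour[OF c] fac \<sigma> by simp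
    show "neighbour m L \<sigma> = K" using mesh_neighbour[OF c(2,1)] c(3) fac \<sigma>' by simp
    show "0 < facet_dist m \<sigma>"
      using mesh_center_inj[OF c(1,2)] c(3) by (simp add: facet_dist_def KL)
    show "0 < area \<sigma>" by (rule mesh_area_pos[OF fac])
    show "{M \<in> cells m. \<sigma> \<in> interior_facets_of m M} = {K, L}"
      using mesh_facets_of_iff[OF c] fac assms c(1,2)
      unfolding interior_facets_of_def \<sigma> by blast
  qed
qed

text \<open>Exchanging the order of summation leaves, for each interior facet, a sum over the two
  cells that list it.\<close>

lemma sum_facets_by_parts:
  fixes \<phi> :: "'a set \<Rightarrow> real"
  shows "(\<Sum>K\<in>cells m. \<phi> K * (\<Sum>\<sigma>\<in>interior_facets_of m K. F K \<sigma>)) =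
    (\<Sum>\<sigma>\<in>interior_facets m. case facet_cells m \<sigma> of (K, L) \<Rightarrow> \<phi> K * F K \<sigma> + \<phi> L * F L \<sigma>)"
proof -
  have "(\<Sum>K\<in>cells m. \<phi> K * (\<Sum>\<sigma>\<in>interior_facets_of m K. F K \<sigma>)) =
      (\<Sum>K\<in>cells m. \<Sum>\<sigma> | \<sigma> \<in> interior_facets m \<and> \<sigma> \<in> interior_facets_of m K. \<phi> K * F K \<sigma>)"
    by (auto simp: sum_distrib_left interior_facets_of_def intro!: sum.cong)
  also have "\<dots> =
      (\<Sum>\<sigma>\<in>interior_facets m. \<Sum>K | K \<in> cells m \<and> \<sigma> \<in> interior_facets_of m K. \<phi> K * F K \<sigma>)"
    by (rule sum.swap_restrict[OF mesh_finite_cells mesh_finite_interior_facets])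
  also have "\<dots> = (\<Sum>\<sigma>\<in>interior_facets m.
      case facet_cells m \<sigma> of (K, L) \<Rightarrow> \<phi> K * F K \<sigma> + \<phi> L * F L \<sigma>)"
  proof (rule sum.cong)
    fix \<sigma> assume "\<sigma> \<in> interior_facets m"
    then show "(\<Sum>K | K \<in> cells m \<and> \<sigma> \<in> interior_facets_of m K. \<phi> K * F K \<sigma>) =
        (case facet_cells m \<sigma> of (K, L) \<Rightarrow> \<phi> K * F K \<sigma> + \<phi> L * F L \<sigma>)"
      by (rule mesh_interior_facetE) simp
  qed simp
  finally show ?thesis .
qed

section \<open>Fluxes at a minimum of \<theta> / \<pi>\<close>

lemma interior_facet_ofE:
  assumes "K \<in> cells m" "\<sigma> \<in> interior_facets_of m K"
  obtains L where "L \<in> cells m" "neighbour m K \<sigma> = L" "0 < facet_dist m \<sigma>" "0 < area \<sigma>"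
proof -
  have "\<sigma> \<in> interior_facets m" using assms(2) by (simp add: interior_facets_of_def)
  then obtain K' L' where *: "K' \<in> cells m" "L' \<in> cells m"
    "neighbour m K' \<sigma> = L'" "neighbour m L' \<sigma> = K'" "0 < facet_dist m \<sigma>" "0 < area \<sigma>"
    "{M \<in> cells m. \<sigma> \<in> interior_facets_of m M} = {K', L'}"
    by (rule mesh_interior_facetE)
  then have "K = K' \<or> K = L'" using assms by blast
  then show thesis using * that by blast
qed

text \<open>The flux is a positive multiple of the difference of \<theta> / \<pi> across the facet,
  so at a minimum nothing flows out, and a vanishing flux makes the neighbour a minimum too.\<close>

lemma scheme_flux_nonpos_at_min:
  assumes K: "K \<in> cells m" and \<sigma>: "\<sigma> \<in> interior_facets_of m K"
    and min: "\<And>L. L \<in> cells m \<Longrightarrow> \<theta> K / cell_weight m V K \<le> \<theta> L / cell_weight m V L"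
  shows "area \<sigma> * scheme_flux m V \<theta> K \<sigma> \<le> 0"
    and "area \<sigma> * scheme_flux m V \<theta> K \<sigma> = 0 \<Longrightarrow> neighbour m K \<sigma> \<in> cells m \<and>
      \<theta> (neighbour m K \<sigma>) / cell_weight m V (neighbour m K \<sigma>) = \<theta> K / cell_weight m V K"
proof -
  obtain L where L: "L \<in> cells m" "neighbour m K \<sigma> = L" "0 < facet_dist m \<sigma>" "0 < area \<sigma>"
    using interior_facet_ofE[OF K \<sigma>] .
  define c where "c = sqrt (cell_weight m V K * cell_weight m V L) / facet_dist m \<sigma>"
  have c: "c > 0" using L(3) by (simp add: c_def cell_weight_def)
  have fl: "scheme_flux m V \<theta> K \<sigma> = c * (\<theta> K / cell_weight m V K - \<theta> L / cell_weight m V L)"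
    by (simp add: scheme_flux_def L(2) c_def Let_def)
  show "area \<sigma> * scheme_flux m V \<theta> K \<sigma> \<le> 0"
    unfolding fl using c L(4) min[OF L(1)] by (intro mult_nonneg_nonpos) auto
  show "neighbour m K \<sigma> \<in> cells m \<and>
      \<theta> (neighbour m K \<sigma>) / cell_weight m V (neighbour m K \<sigma>) = \<theta> K / cell_weight m V K"
    if "area \<sigma> * scheme_flux m V \<theta> K \<sigma> = 0"
    using that c L by (simp add: fl)
qed

section \<open>A single time step: nonnegativity, dissipation, energy\<close>

context
  fixes V :: "'a \<Rightarrow> real" and \<tau> :: real and \<rho> \<rho>' \<theta> :: "'a set \<Rightarrow> real"
  assumes \<tau>: "0 < \<tau>"
    and \<rho>: "\<And>K. K \<in> cells m \<Longrightarrow> 0 \<le> \<rho> K"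
    and balance: "\<And>K. K \<in> cells m \<Longrightarrow> vol K * ((\<rho>' K - \<rho> K) / \<tau>) +
      (\<Sum>\<sigma>\<in>interior_facets_of m K. area \<sigma> * scheme_flux m V \<theta> K \<sigma>) = 0"
    and extrapolation: "\<And>K. K \<in> cells m \<Longrightarrow> \<rho>' K = extrap (\<rho> K) (\<theta> K)"
begin

text \<open>No outflow at a minimum means that mass cannot decrease there. From positive mass,
  \<open>extrap_ge_imp_pos\<close> gives positive \<theta>; from zero mass the new value is e times
  \<theta>, whose sign is then known.\<close>

lemma step_mass_at_min:
  assumes K: "K \<in> cells m"
    and min: "\<And>L. L \<in> cells m \<Longrightarrow> \<theta> K / cell_weight m V K \<le> \<theta> L / cell_weight m V L"
  shows "\<rho> K \<le> \<rho>' K" and "\<rho> K > 0 \<Longrightarrow> \<theta> K > 0" and "\<theta> K \<ge> 0"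
proof -
  have "(\<Sum>\<sigma>\<in>interior_facets_of m K. area \<sigma> * scheme_flux m V \<theta> K \<sigma>) \<le> 0"
    using scheme_flux_nonpos_at_min(1)[OF K _ min] by (intro sum_nonpos) auto
  then have "0 \<le> vol K * ((\<rho>' K - \<rho> K) / \<tau>)" using balance[OF K] by linarith
  then show le: "\<rho> K \<le> \<rho>' K"
    using mesh_vol_pos[OF K] \<tau> by (simp add: zero_le_mult_iff zero_le_divide_iff)
  show pos: "\<rho> K > 0 \<Longrightarrow> \<theta> K > 0"
    using le extrapolation[OF K] extrap_ge_imp_pos[of "\<rho> K" "\<theta> K"] by simp
  show "\<theta> K \<ge> 0"
  proof (cases "\<rho> K > 0")
    case False
    then have "\<rho> K = 0" using \<rho>[OF K] by simp
    then show ?thesis using le extrapolation[OF K] by (simp add: extrap_def zero_le_mult_iff)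
  qed (use pos in simp)
qed

text \<open>The minimum of \<theta> / \<pi> over the finitely many cells is nonnegative, and the
  weights are positive.\<close>

lemma step_theta_nonneg: assumes K: "K \<in> cells m" shows "0 \<le> \<theta> K"
proof -
  define u where "u = (\<lambda>L. \<theta> L / cell_weight m V L)"
  have "finite (u ` cells m)" "u ` cells m \<noteq> {}" using mesh_finite_cells K by auto
  then have "Min (u ` cells m) \<in> u ` cells m" by (rule Min_in)
  then obtain K0 where K0: "K0 \<in> cells m" "u K0 = Min (u ` cells m)" by auto
  then have min: "u K0 \<le> u L" if "L \<in> cells m" for L
    using that mesh_finite_cells by simp
  have "0 \<le> \<theta> K0" using step_mass_at_min(3)[OF K0(1)] min by (simp add: u_def)
  then have "0 \<le> u K0" by (simp add: u_def cell_weight_def)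
  then have "0 \<le> u K" using min[OF K] by simp
  then show ?thesis by (simp add: u_def cell_weight_def zero_le_divide_iff)
qed

text \<open>
  A cell with \<open>\<theta> K = 0\<close> is a minimum point, so vanishing spreads to its neighbours. This
  replaces the strict positivity of \<open>\<theta>\<close>, for which one would need the mesh to be connected:
  with \<open>ln 0 = 0\<close> and \<open>x / 0 = 0\<close>, every term of the balance attached to such a cell is zero.
\<close>

lemma step_theta_zero:
  assumes K: "K \<in> cells m" and 0: "\<theta> K = 0"
  shows "\<rho> K = 0" "\<rho>' K = 0"
    and "\<And>\<sigma>. \<sigma> \<in> interior_facets_of m K \<Longrightarrow> \<theta> (neighbour m K \<sigma>) = 0"
proof -
  have min: "\<theta> K / cell_weight m V K \<le> \<theta> L / cell_weight m V L" if "L \<in> cells m" for L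
    using step_theta_nonneg[OF that] by (simp add: 0 cell_weight_def)
  show r: "\<rho> K = 0" using step_mass_at_min(2)[OF K min] \<rho>[OF K] 0 by force
  show r': "\<rho>' K = 0" using extrapolation[OF K] by (simp add: r 0 extrap_def)
  fix \<sigma> assume \<sigma>: "\<sigma> \<in> interior_facets_of m K"
  have fin: "finite (interior_facets_of m K)"
    using mesh_finite_interior_facets by (simp add: interior_facets_of_def)
  \<comment> \<open>Mass is zero before and after the step, so the fluxes sum to zero; none of them
    is positive, hence each vanishes.\<close>
  have "(\<Sum>\<sigma>\<in>interior_facets_of m K. - (area \<sigma> * scheme_flux m V \<theta> K \<sigma>)) = 0"
    using balance[OF K] by (simp add: r r' sum_negf)
  moreover have "0 \<le> - (area \<sigma>' * scheme_flux m V \<theta> K \<sigma>')" if "\<sigma>' \<in> interior_facets_of m K" for \<sigma>'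
    using scheme_flux_nonpos_at_min(1)[OF K that min] by simp
  ultimately have "- (area \<sigma> * scheme_flux m V \<theta> K \<sigma>) = 0"
    using \<sigma> by (subst (asm) sum_nonneg_eq_0_iff[OF fin]) auto
  then have "\<theta> (neighbour m K \<sigma>) / cell_weight m V (neighbour m K \<sigma>) = 0"
    using scheme_flux_nonpos_at_min(2)[OF K \<sigma> min] by (simp add: 0)
  then show "\<theta> (neighbour m K \<sigma>) = 0" by (simp add: cell_weight_def)
qed

lemma step_mass_nonneg: "K \<in> cells m \<Longrightarrow> 0 \<le> \<rho>' K"
  using extrapolation step_theta_nonneg extrap_nonneg by simp

text \<open>The facet identity times the area, rewritten with opposite fluxes from the two sides.
  Spreading of zeros excludes that \<theta> vanishes in exactly one of the two cells.\<close>

lemma step_facet_dissipation: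
  assumes \<sigma>: "\<sigma> \<in> interior_facets m"
  defines "\<phi> \<equiv> \<lambda>K. ln (\<theta> K / cell_weight m V K)"
  shows "area \<sigma> * facet_density m \<theta> \<sigma> / facet_dist m \<sigma> *
      psi (facet_dist m \<sigma> * facet_flux m (scheme_flux m V \<theta>) \<sigma> / facet_density m \<theta> \<sigma>) +
    (case facet_cells m \<sigma> of (K, L) \<Rightarrow>
      area \<sigma> * facet_density m \<theta> \<sigma> / facet_dist m \<sigma> * psi_star (\<phi> K - \<phi> L)) =
    (case facet_cells m \<sigma> of (K, L) \<Rightarrow>
      \<phi> K * (area \<sigma> * scheme_flux m V \<theta> K \<sigma>) + \<phi> L * (area \<sigma> * scheme_flux m V \<theta> L \<sigma>))"
proof -
  obtain K L where KL: "facet_cells m \<sigma> = (K, L)" "K \<in> cells m" "L \<in> cells m" "K \<noteq> L"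
    "neighbour m K \<sigma> = L" "neighbour m L \<sigma> = K" and d: "0 < facet_dist m \<sigma>" "0 < area \<sigma>"
    and pair: "{M \<in> cells m. \<sigma> \<in> interior_facets_of m M} = {K, L}"
    using mesh_interior_facetE[OF \<sigma>] .
  let ?\<pi> = "cell_weight m V"
  define F where "F = sqrt (?\<pi> K * ?\<pi> L) / facet_dist m \<sigma> * (\<theta> K / ?\<pi> K - \<theta> L / ?\<pi> L)"
  have FK: "scheme_flux m V \<theta> K \<sigma> = F"
    by (simp add: scheme_flux_def KL F_def Let_def)
  have FL: "scheme_flux m V \<theta> L \<sigma> = - F"
    by (simp add: scheme_flux_def KL F_def Let_def mult.commute[of "?\<pi> L"] right_diff_distrib)
  have "\<sigma> \<in> interior_facets_of m K" "\<sigma> \<in> interior_facets_of m L" using pair by blast+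
  then have zero: "\<theta> K = 0 \<longleftrightarrow> \<theta> L = 0"
    using step_theta_zero(3)[OF KL(2), of \<sigma>] step_theta_zero(3)[OF KL(3), of \<sigma>] KL(5,6) by auto
  have pos: "\<theta> K > 0 \<and> \<theta> L > 0 \<or> \<theta> K = 0 \<and> \<theta> L = 0"
    using zero step_theta_nonneg[OF KL(2)] step_theta_nonneg[OF KL(3)] by linarith
  let ?r = "sqrt (\<theta> K * \<theta> L)" and ?d = "facet_dist m \<sigma>"
  have "?r / ?d * psi (?d * \<bar>F\<bar> / ?r) + ?r / ?d * psi_star (\<phi> K - \<phi> L) = F * (\<phi> K - \<phi> L)"
    unfolding F_def \<phi>_def using d pos
    by (intro facet_dissipation_identity) (auto simp: cell_weight_def)
  then have "area \<sigma> * (?r / ?d * psi (?d * \<bar>F\<bar> / ?r) + ?r / ?d * psi_star (\<phi> K - \<phi> L)) =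
      area \<sigma> * (F * (\<phi> K - \<phi> L))" by simp
  then show ?thesis
    by (simp add: facet_density_def facet_flux_def KL(1) FK FL algebra_simps)
qed

text \<open>Summing the facet identities, integrating by parts and inserting the mass balance
  replaces the fluxes by mass increments.\<close>

lemma step_dissipation:
  "\<tau> * (dissipation_flux m \<theta> (scheme_flux m V \<theta>) + dissipation_slope m V \<theta>) =
    - (\<Sum>K\<in>cells m. vol K * (\<rho>' K - \<rho> K) * ln (\<theta> K / cell_weight m V K))"
proof -
  define \<phi> where "\<phi> = (\<lambda>K. ln (\<theta> K / cell_weight m V K))"
  have "dissipation_flux m \<theta> (scheme_flux m V \<theta>) + dissipation_slope m V \<theta> =
      (\<Sum>\<sigma>\<in>interior_facets m. case facet_cells m \<sigma> of (K, L) \<Rightarrow>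
        \<phi> K * (area \<sigma> * scheme_flux m V \<theta> K \<sigma>) + \<phi> L * (area \<sigma> * scheme_flux m V \<theta> L \<sigma>))"
    unfolding dissipation_flux_def dissipation_slope_def \<phi>_def
    using step_facet_dissipation by (subst sum.distrib[symmetric], intro sum.cong) auto
  also have "\<dots> = (\<Sum>K\<in>cells m. \<phi> K *
      (\<Sum>\<sigma>\<in>interior_facets_of m K. area \<sigma> * scheme_flux m V \<theta> K \<sigma>))"
    by (rule sum_facets_by_parts[symmetric])
  also have "\<dots> = (\<Sum>K\<in>cells m. \<phi> K * - (vol K * ((\<rho>' K - \<rho> K) / \<tau>)))"
  proof (rule sum.cong[OF refl])
    fix K assume "K \<in> cells m"
    from balance[OF this] have "(\<Sum>\<sigma>\<in>interior_facets_of m K. area \<sigma> * scheme_flux m V \<theta> K \<sigma>) =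
        - (vol K * ((\<rho>' K - \<rho> K) / \<tau>))" by linarith
    then show "\<phi> K * (\<Sum>\<sigma>\<in>interior_facets_of m K. area \<sigma> * scheme_flux m V \<theta> K \<sigma>) =
        \<phi> K * - (vol K * ((\<rho>' K - \<rho> K) / \<tau>))" by simp
  qed
  finally show ?thesis
    using \<tau> by (simp add: \<phi>_def sum_distrib_left sum_negf mult_ac)
qed

text \<open>Since ln \<pi> = - V, the logarithm of \<theta> / \<pi> is ln \<theta> + V: the entropy
  estimate for the extrapolation absorbs the potential energy exactly. A cell with \<theta> = 0 has
  no mass before or after the step.\<close>

lemma step_cell_energy:
  assumes K: "K \<in> cells m"
  defines "\<phi> \<equiv> ln (\<theta> K / cell_weight m V K)"
    and "h \<equiv> \<lambda>r. entropy_density r + V (center m K) * r"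
  shows "h (\<rho>' K) - h (\<rho> K) \<le> (\<rho>' K - \<rho> K) * \<phi>"
    and "\<theta> K \<ge> exp (- 1) * \<rho> K \<Longrightarrow> h (\<rho>' K) - h (\<rho> K) = (\<rho>' K - \<rho> K) * \<phi>"
proof -
  have "h (\<rho>' K) - h (\<rho> K) \<le> (\<rho>' K - \<rho> K) * \<phi> \<and>
    (\<theta> K \<ge> exp (- 1) * \<rho> K \<longrightarrow> h (\<rho>' K) - h (\<rho> K) = (\<rho>' K - \<rho> K) * \<phi>)"
  proof (cases "\<theta> K = 0")
    case True
    then show ?thesis using step_theta_zero(1,2)[OF K] by simp
  next
    case False
    then have pos: "\<theta> K > 0" using step_theta_nonneg[OF K] by simp
    have "\<phi> = ln (\<theta> K) + V (center m K)"
      using pos by (simp add: \<phi>_def cell_weight_def ln_div)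
    then show ?thesis
      using extrap_entropy_le[OF \<rho>[OF K] pos] extrapolation[OF K]
      by (simp add: h_def algebra_simps)
  qed
  then show "h (\<rho>' K) - h (\<rho> K) \<le> (\<rho>' K - \<rho> K) * \<phi>"
    and "\<theta> K \<ge> exp (- 1) * \<rho> K \<Longrightarrow> h (\<rho>' K) - h (\<rho> K) = (\<rho>' K - \<rho> K) * \<phi>" by auto
qed

lemma step_energy:
  shows "discrete_energy m V \<rho>' + \<tau> * dissipation_flux m \<theta> (scheme_flux m V \<theta>) +
      \<tau> * dissipation_slope m V \<theta> \<le> discrete_energy m V \<rho>"
    and "(\<And>K. K \<in> cells m \<Longrightarrow> \<theta> K \<ge> exp (- 1) * \<rho> K) \<Longrightarrow>
      discrete_energy m V \<rho>' + \<tau> * dissipation_flux m \<theta> (scheme_flux m V \<theta>) +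
      \<tau> * dissipation_slope m V \<theta> = discrete_energy m V \<rho>"
proof -
  define h where "h = (\<lambda>K r. entropy_density r + V (center m K) * r)"
  have E: "discrete_energy m V \<rho>' - discrete_energy m V \<rho> =
      (\<Sum>K\<in>cells m. vol K * (h K (\<rho>' K) - h K (\<rho> K)))"
    unfolding discrete_energy_def h_def
    by (simp add: algebra_simps flip: sum.distrib sum_subtractf)
  have D: "\<tau> * dissipation_flux m \<theta> (scheme_flux m V \<theta>) + \<tau> * dissipation_slope m V \<theta> =
      - (\<Sum>K\<in>cells m. vol K * ((\<rho>' K - \<rho> K) * ln (\<theta> K / cell_weight m V K)))"
    using step_dissipation by (simp add: distrib_left mult.assoc)
  have "(\<Sum>K\<in>cells m. vol K * (h K (\<rho>' K) - h K (\<rho> K))) \<le>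
      (\<Sum>K\<in>cells m. vol K * ((\<rho>' K - \<rho> K) * ln (\<theta> K / cell_weight m V K)))"
    using step_cell_energy(1) mesh_vol_pos unfolding h_def
    by (intro sum_mono mult_left_mono) (auto intro: less_imp_le)
  then show "discrete_energy m V \<rho>' + \<tau> * dissipation_flux m \<theta> (scheme_flux m V \<theta>) +
      \<tau> * dissipation_slope m V \<theta> \<le> discrete_energy m V \<rho>"
    using E D by linarith
  assume "\<And>K. K \<in> cells m \<Longrightarrow> \<theta> K \<ge> exp (- 1) * \<rho> K"
  then have "(\<Sum>K\<in>cells m. vol K * (h K (\<rho>' K) - h K (\<rho> K))) =
      (\<Sum>K\<in>cells m. vol K * ((\<rho>' K - \<rho> K) * ln (\<theta> K / cell_weight m V K)))"
    using step_cell_energy(2) unfolding h_def by (intro sum.cong) auto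
  then show "discrete_energy m V \<rho>' + \<tau> * dissipation_flux m \<theta> (scheme_flux m V \<theta>) +
      \<tau> * dissipation_slope m V \<theta> = discrete_energy m V \<rho>"
    using E D by linarith
qed

end

section \<open>Initial averages and induction over the time steps\<close>

lemma initial_cell_average_nonneg:
  assumes K: "K \<in> cells m" and nonneg: "AE x\<in>\<Omega> in lebesgue. 0 \<le> (\<rho>0 x :: real)"
  shows "0 \<le> (LINT x:K|lebesgue. \<rho>0 x) / vol K"
proof -
  have "AE x in lebesgue. 0 \<le> indicator K x *\<^sub>R \<rho>0 x"
    using nonneg by eventually_elim (use mesh_cell_subset[OF K] in \<open>auto simp: indicator_def\<close>)
  then have "0 \<le> (LINT x:K|lebesgue. \<rho>0 x)"
    unfolding set_lebesgue_integral_def by (rule integral_nonneg_AE)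
  then show ?thesis using mesh_vol_pos[OF K] by simp
qed

end

theorem proposition3p2:
  fixes \<Omega> :: "'a::euclidean_space set"
    and V \<rho>0 :: "'a \<Rightarrow> real"
    and T \<tau> :: real and N :: nat
    and m :: "'a mesh"
    and \<rho> \<theta> :: "nat \<Rightarrow> 'a set \<Rightarrow> real"
  assumes domain: "open \<Omega>" "bounded \<Omega>" "convex \<Omega>" "open_polyhedron \<Omega>"
    and potential: "C2_closure \<Omega> V"
    and time: "0 < T" "1 \<le> N" "\<tau> = T / real N"
    and initial: "set_integrable lebesgue \<Omega> \<rho>0"
      "AE x\<in>\<Omega> in lebesgue. 0 \<le> \<rho>0 x"
      "(\<integral>\<^sup>+x\<in>\<Omega>. ennreal (entropy_density (\<rho>0 x)) \<partial>lebesgue) < \<infinity>"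
      "0 < (LINT x:\<Omega>|lebesgue. \<rho>0 x)"
    and mesh: "admissible_mesh \<Omega> m"
    and solution: "discrete_solution m V \<rho>0 \<tau> N \<rho> \<theta>"
  shows "\<forall>n < N.
      discrete_energy m V (\<rho> (Suc n)) +
          \<tau> * dissipation_flux m (\<theta> n) (scheme_flux m V (\<theta> n)) +
          \<tau> * dissipation_slope m V (\<theta> n)
        \<le> discrete_energy m V (\<rho> n) \<and>
      ((\<forall>K \<in> cells m. \<theta> n K \<ge> exp (-1) * \<rho> n K) \<longrightarrow>
        discrete_energy m V (\<rho> (Suc n)) +
            \<tau> * dissipation_flux m (\<theta> n) (scheme_flux m V (\<theta> n)) +
            \<tau> * dissipation_slope m V (\<theta> n)
          = discrete_energy m V (\<rho> n))"
proof -
  have \<tau>: "0 < \<tau>" using time by simp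
  have sol0: "\<rho> 0 K = (LINT x:K|lebesgue. \<rho>0 x) / vol K" if "K \<in> cells m" for K
    using solution that by (simp add: discrete_solution_def)
  have sol: "vol K * ((\<rho> (Suc n) K - \<rho> n K) / \<tau>) +
        (\<Sum>\<sigma>\<in>interior_facets_of m K. area \<sigma> * scheme_flux m V (\<theta> n) K \<sigma>) = 0"
    "\<rho> (Suc n) K = extrap (\<rho> n K) (\<theta> n K)" if "n < N" "K \<in> cells m" for n K
    using solution that unfolding discrete_solution_def by blast+
  \<comment> \<open>\<open>discrete_solution\<close> does not include nonnegativity of the
    densities. It starts from the cell averages and passes through each step, up to and including n
    = N.\<close>
  have nonneg: "\<forall>K\<in>cells m. 0 \<le> \<rho> n K" if "n \<le> N" for n
    using that
  proof (induction n)
    case 0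
    then show ?case
      using initial_cell_average_nonneg[OF domain(1-3) mesh _ initial(2)] sol0 by simp
  next
    case (Suc n)
    then have n: "n < N" and \<rho>: "\<And>K. K \<in> cells m \<Longrightarrow> 0 \<le> \<rho> n K" by auto
    show ?case
      by (intro ballI) (rule step_mass_nonneg[OF domain(1-3) mesh \<tau> \<rho> sol(1)[OF n] sol(2)[OF n]])
  qed
  show ?thesis
  proof (intro allI impI conjI)
    fix n assume n: "n < N"
    have \<rho>: "0 \<le> \<rho> n K" if "K \<in> cells m" for K
      using nonneg[of n] n that by simp
    show "discrete_energy m V (\<rho> (Suc n)) +
          \<tau> * dissipation_flux m (\<theta> n) (scheme_flux m V (\<theta> n)) +
          \<tau> * dissipation_slope m V (\<theta> n) \<le> discrete_energy m V (\<rho> n)"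
      by (rule step_energy(1)[OF domain(1-3) mesh \<tau> \<rho> sol(1)[OF n] sol(2)[OF n]])
    assume "\<forall>K\<in>cells m. \<theta> n K \<ge> exp (- 1) * \<rho> n K"
    then show "discrete_energy m V (\<rho> (Suc n)) +
          \<tau> * dissipation_flux m (\<theta> n) (scheme_flux m V (\<theta> n)) +
          \<tau> * dissipation_slope m V (\<theta> n) = discrete_energy m V (\<rho> n)"
      by (intro step_energy(2)[OF domain(1-3) mesh \<tau> \<rho> sol(1)[OF n] sol(2)[OF n]]) auto
  qed
qed

end
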